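(* Let $C$ be a copula on $[0,1]^m$. The following are equivalent: (i) $C$ is in the domain of attraction of an $m$-dimensional extreme value distribution (EVD) $G$, normalized to have standard negative exponential margins; (ii) there exists a generalized Pareto distribution (GPD) $W$ on $\mathbb{R}^m$ with ultimately uniform margins such that $$C(\mathbf{y})=W(\mathbf{y}-\mathbf{1})+o(\|\mathbf{y}-\mathbf{1}\|)$$ uniformly for $\mathbf{y}\in[0,1]^m$; (iii) there exists a norm $\|\cdot\|_D$ on $\mathbb{R}^m$ such that $$C(\mathbf{y})=1-\|\mathbf{y}-\mathbf{1}\|_D+o(\|\mathbf{y}-\mathbf{1}\|_D)$$ uniformly for $\mathbf{y}\in[0,1]^m$. Moreover, in this case, $W$ in (ii) satisfies $W(\mathbf{x})=1+\log(G(\mathbf{x}))$ for $\mathbf{x}_0\le\mathbf{x}\le\mathbf{0}\in\mathbb{R}^m$ with some $\mathbf{x}_0<\mathbf{0}$, and with the norm in (iii) one has $G(\mathbf{x})=\exp(-\|\mathbf{x}\|_D)$ for all $\mathbf{x}\le\mathbf{0}$.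
   Context: Operations and inequalities between vectors are componentwise; $\mathbf{1}=(1,\dots,1)$, $\mathbf{0}=(0,\dots,0)$; $\|\cdot\|$ is an arbitrary norm on $\mathbb{R}^m$. A copula on $[0,1]^m$ is a distribution function all of whose univariate margins are uniform on $[0,1]$; it is regarded as a distribution function on $\mathbb{R}^m$. Domain of attraction: a distribution function $F$ is in the domain of attraction of $G$ if there are $\mathbf{a}_n>\mathbf{0}$, $\mathbf{b}_n\in\mathbb{R}^m$ with $F^n(\mathbf{a}_n\mathbf{x}+\mathbf{b}_n)\to G(\mathbf{x})$ as $n\to\infty$ for all $\mathbf{x}\in\mathbb{R}^m$. EVD: a distribution function $G$ on $\mathbb{R}^m$ with non-degenerate margins that is max-stable, i.e. for every $n\in\mathbb{N}$ there are $\mathbf{c}_n>\mathbf{0}$, $\mathbf{d}_n\in\mathbb{R}^m$ with $G^n(\mathbf{c}_n\mathbf{x}+\mathbf{d}_n)=G(\mathbf{x})$ for all $\mathbf{x}$. Standard negative exponential margins means $G_i(x)=\exp(x)$, $x\le 0$, for all $i\le m$. GPD with ultimately uniform margins: a distribution function $W$ on $\mathbb{R}^m$ for which there are $\mathbf{x}_0<\mathbf{0}$ and an EVD $G'$ with standard negative exponential margins such that $W(\mathbf{x})=1+\log(G'(\mathbf{x}))$ for $\mathbf{x}_0\le\mathbf{x}\le\mathbf{0}$; in particular its margins satisfy $W_i(x)=1+x$ for $x\le 0$ close to $0$. "$o(\|\mathbf{y}-\mathbf{1}\|)$ uniformly for $\mathbf{y}\in[0,1]^m$" means: for every $\varepsilon>0$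 there is $\delta>0$ such that the remainder is at most $\varepsilon\|\mathbf{y}-\mathbf{1}\|$ in absolute value for all $\mathbf{y}\in[0,1]^m$ with $\|\mathbf{y}-\mathbf{1}\|\le\delta$; similarly for $\|\cdot\|_D$. *)

theory Defs
  imports "HOL-Probability.Probability"
begin

text \<open>
  Componentwise vector operations are those of the type \<^typ>\<open>real ^ 'm\<close>: in particular
  \<open>1\<close> is the vector of ones, \<open>a * x\<close> is the componentwise product and \<open>x \<le> y\<close> is componentwise.
  The library's \<open>x < y\<close> on this type only means \<open>x \<le> y \<and> x \<noteq> y\<close>, so strict inequalities are
  written out in every component.
\<close>

definition distribution_function :: "(real ^ 'm \<Rightarrow> real) \<Rightarrow> bool" where
  "distribution_function F \<longleftrightarrow>
     (\<exists>M. prob_space M \<and> sets M = sets borel \<and> (\<forall>x. F x = measure M {..x}))"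

text \<open>
  The \<open>i\<close>-th univariate margin: all other arguments tend to infinity. The lemma below shows that it
  is the distribution function of the \<open>i\<close>-th coordinate.
\<close>

definition margin :: "'m \<Rightarrow> (real ^ 'm \<Rightarrow> real) \<Rightarrow> real \<Rightarrow> real" where
  "margin i F t = Lim at_top (\<lambda>s. F (\<chi> j. if j = i then t else s))"

lemma margin_eq_cdf:
  fixes M :: "(real ^ 'm) measure"
  assumes "prob_space M" and sets: "sets M = sets borel"
  shows "margin i (\<lambda>x. measure M {..x}) t = cdf (distr M borel (\<lambda>x. x $ i)) t"
proof -
  interpret prob_space M by fact
  define A where "A s = {..(\<chi> j. if j = i then t else s) :: real ^ 'm}" for s :: real
  have A_iff: "x \<in> A s \<longleftrightarrow> x $ i \<le> t \<and> (\<forall>j. j \<noteq> i \<longrightarrow> x $ j \<le> s)" for x s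
    by (auto simp: A_def less_eq_vec_def split: if_splits)
  have A_sets: "A s \<in> sets M" for s
    by (simp add: sets A_def)
  have mono: "A s \<subseteq> A s'" if "s \<le> s'" for s s'
    using that by (fastforce simp: A_iff)
  have union: "(\<Union>n. A (real n)) = {x. x $ i \<le> t}"
  proof (intro equalityI subsetI)
    fix x :: "real ^ 'm" assume x: "x \<in> {x. x $ i \<le> t}"
    obtain n where n: "norm x \<le> real n" using real_arch_simple by blast
    have "x $ j \<le> real n" for j
      using component_le_norm_cart[of x j] n by linarith
    then show "x \<in> (\<Union>n. A (real n))" using x by (auto simp: A_iff)
  qed (auto simp: A_iff)
  have "(\<lambda>n. measure M (A (real n))) \<longlonglongrightarrow> measure M (\<Union>n. A (real n))"
    by (intro finite_Lim_measure_incseq) (auto simp: A_sets incseq_def intro!: mono)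
  then have "((\<lambda>s. measure M (A s)) \<longlongrightarrow> measure M {x. x $ i \<le> t}) at_top"
    unfolding union
    by (intro tendsto_at_topI_sequentially_real)
       (auto intro!: monoI finite_measure_mono mono A_sets)
  then have "margin i (\<lambda>x. measure M {..x}) t = measure M {x. x $ i \<le> t}"
    unfolding margin_def A_def by (intro tendsto_Lim) auto
  moreover have "(\<lambda>x. x $ i) \<in> M \<rightarrow>\<^sub>M borel"
    unfolding measurable_cong_sets[OF sets refl] by measurable
  moreover have "space M = UNIV"
    using sets_eq_imp_space_eq[OF sets] by simp
  ultimately show ?thesis
    by (simp add: cdf_def measure_distr vimage_def)
qed

definition copula :: "(real ^ 'm \<Rightarrow> real) \<Rightarrow> bool" where
  "copula C \<longleftrightarrow> distribution_function C \<and> (\<forall>i. \<forall>t\<in>{0..1}. margin i C t = t)"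

definition in_domain_of_attraction ::
    "(real ^ 'm \<Rightarrow> real) \<Rightarrow> (real ^ 'm \<Rightarrow> real) \<Rightarrow> bool" where
  "in_domain_of_attraction F G \<longleftrightarrow>
     (\<exists>a b. (\<forall>n i. a n $ i > 0) \<and> (\<forall>x. (\<lambda>n. F (a n * x + b n) ^ n) \<longlonglongrightarrow> G x))"

definition degenerate :: "(real \<Rightarrow> real) \<Rightarrow> bool" where
  "degenerate H \<longleftrightarrow> (\<exists>c. \<forall>t. H t = (if c \<le> t then 1 else 0))"

definition max_stable :: "(real ^ 'm \<Rightarrow> real) \<Rightarrow> bool" where
  "max_stable G \<longleftrightarrow>
     (\<forall>n\<ge>1. \<exists>c d. (\<forall>i. c $ i > 0) \<and> (\<forall>x. G (c * x + d) ^ n = G x))"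

definition evd :: "(real ^ 'm \<Rightarrow> real) \<Rightarrow> bool" where
  "evd G \<longleftrightarrow> distribution_function G \<and> (\<forall>i. \<not> degenerate (margin i G)) \<and> max_stable G"

definition std_neg_exp_margins :: "(real ^ 'm \<Rightarrow> real) \<Rightarrow> bool" where
  "std_neg_exp_margins G \<longleftrightarrow> (\<forall>i. \<forall>t\<le>0. margin i G t = exp t)"

definition gpd_uniform :: "(real ^ 'm \<Rightarrow> real) \<Rightarrow> bool" where
  "gpd_uniform W \<longleftrightarrow> distribution_function W \<and>
     (\<exists>x0 G. (\<forall>i. x0 $ i < 0) \<and> evd G \<and> std_neg_exp_margins G \<and>
        (\<forall>x. x0 \<le> x \<and> x \<le> 0 \<longrightarrow> W x = 1 + ln (G x)))"

text \<open>
  The library's \<open>norm\<close> is the one fixed Euclidean norm of the type; this predicate says that a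
  function is an arbitrary norm. Nonnegativity follows from the three conditions.
\<close>

definition is_norm :: "('a::real_vector \<Rightarrow> real) \<Rightarrow> bool" where
  "is_norm N \<longleftrightarrow> (\<forall>x. N x = 0 \<longleftrightarrow> x = 0) \<and> (\<forall>c x. N (c *\<^sub>R x) = \<bar>c\<bar> * N x) \<and>
     (\<forall>x y. N (x + y) \<le> N x + N y)"

text \<open>\<open>R y = o(N (y - 1))\<close> uniformly for \<open>y\<close> in the unit cube.\<close>

definition unif_small_o :: "(real ^ 'm \<Rightarrow> real) \<Rightarrow> (real ^ 'm \<Rightarrow> real) \<Rightarrow> bool" where
  "unif_small_o N R \<longleftrightarrow>
     (\<forall>\<epsilon>>0. \<exists>\<delta>>0. \<forall>y. 0 \<le> y \<and> y \<le> 1 \<and> N (y - 1) \<le> \<delta> \<longrightarrow> \<bar>R y\<bar> \<le> \<epsilon> * N (y - 1))"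

definition gpd_expansion ::
    "(real ^ 'm \<Rightarrow> real) \<Rightarrow> (real ^ 'm \<Rightarrow> real) \<Rightarrow> (real ^ 'm \<Rightarrow> real) \<Rightarrow> bool" where
  "gpd_expansion N C W \<longleftrightarrow> unif_small_o N (\<lambda>y. C y - W (y - 1))"

definition norm_expansion ::
    "(real ^ 'm \<Rightarrow> real) \<Rightarrow> (real ^ 'm \<Rightarrow> real) \<Rightarrow> bool" where
  "norm_expansion C D \<longleftrightarrow> unif_small_o D (\<lambda>y. C y - (1 - D (y - 1)))"

end

(*
  All three conditions say that n (1 - C (1 + x / n)) converges for x <= 0, with limit
  - log G x = ||x||_D. For the domain of attraction, the margins force n a_n -> 1 and
  n (1 - b_n) -> 0, and C is Lipschitz, so a_n x + b_n may be replaced by 1 + x / n.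
  Convergence along rays is uniform by compactness of the unit sphere.

  The limit is 1-homogeneous and monotone. Its triangle inequality comes from the
  subadditivity of max_i |x_i| X_i with X_i = 1 / (1 - U_i), U ~ C: the expectation of this
  variable truncated at T grows like ||x||_D log T.

  Conversely, G and W have to be produced as distribution functions, being pointwise limits of
  distribution functions. Helly's theorem is only at hand on the real line; measures on the cube
  are transported to it by a Borel section of a continuous space-filling curve, along which weak
  limits can be pushed back.
*)
theory Submission
  imports Defs
begin

section \<open>Distribution functions and their margins\<close>

text \<open>The triangle inequality is the one norm property that does not pass to the limit: the
  functions \<open>n (1 - C (1 + x / n))\<close> have no reason to be subadditive. The truncated
  expectation repairs this because tail probabilities close to ||x||_D / k make it grow like a
  multiple of the harmonic sum, while rounding to integers costs an additive constant only, which
  the divergence of the harmonic series wipes out. After the transport to the line, mass can still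
  be lost to the boundary of the cube; the behaviour of the limit function at infinity excludes
  this. Cutting 1 + log G off from below at 0 would not give a W: for m >= 3 and the sum norm,
  max(0, 1 - ||x||) assigns a negative volume to the cube from -1/2 to 0 and is no distribution
  function. Therefore W is a limit of copula laws conditioned on an exceedance, and it agrees with 1
  - ||x||_D on a box only.\<close>

lemma borel_measurable_vec_lambda:
  fixes f :: "'a \<Rightarrow> 'm::finite \<Rightarrow> real"
  assumes "\<And>i. (\<lambda>x. f x i) \<in> borel_measurable M"
  shows "(\<lambda>x. \<chi> i. f x i) \<in> borel_measurable M"
  unfolding borel_measurable_euclidean_space[of "\<lambda>x. \<chi> i. f x i"]
  using assms by (auto simp: Basis_vec_def inner_axis)

lemma distribution_function_measure:
  fixes F :: "real ^ 'm \<Rightarrow> real"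
  assumes "distribution_function F"
  shows "\<exists>M. prob_space M \<and> sets M = sets borel \<and> space M = UNIV \<and>
    (\<forall>x. F x = measure M {..x}) \<and> (\<forall>i t. margin i F t = measure M {x. x $ i \<le> t})"
proof -
  obtain M where M: "prob_space M" "sets M = sets borel" "\<And>x. F x = measure M {..x}"
    using assms unfolding distribution_function_def by blast
  have sp: "space M = UNIV" using sets_eq_imp_space_eq[OF M(2)] by simp
  have "margin i F t = measure M {x. x $ i \<le> t}" for i t
  proof -
    have "F = (\<lambda>x. measure M {..x})" using M(3) by blast
    moreover have "(\<lambda>x. x $ i) \<in> M \<rightarrow>\<^sub>M borel"
      unfolding measurable_cong_sets[OF M(2) refl] by measurable
    ultimately show ?thesis
      using margin_eq_cdf[OF M(1,2), of i t] sp by (simp add: cdf_def measure_distr vimage_def)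
  qed
  then show ?thesis using M sp by blast
qed

lemma distribution_function_bounds:
  assumes "distribution_function F"
  shows "0 \<le> F x" "F x \<le> 1"
proof -
  obtain M where "prob_space M" and F: "\<And>x. F x = measure M {..x}"
    using distribution_function_measure[OF assms] by blast
  then interpret prob_space M by blast
  show "0 \<le> F x" "F x \<le> 1" by (simp_all add: F)
qed

lemma distribution_function_mono:
  assumes "distribution_function F" "x \<le> y"
  shows "F x \<le> F y"
proof -
  obtain M where "prob_space M" and F: "sets M = sets borel" "\<And>x. F x = measure M {..x}"
    using distribution_function_measure[OF assms(1)] by blast
  then interpret prob_space M by blast
  show ?thesis using assms(2) unfolding F(2) by (intro finite_measure_mono) (auto simp: F(1))
qed

lemma margin_bounds:
  assumes "distribution_function F"
  shows "0 \<le> margin i F t" "margin i F t \<le> 1"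
proof -
  obtain M where "prob_space M" and F: "\<And>i t. margin i F t = measure M {x. x $ i \<le> t}"
    using distribution_function_measure[OF assms] by blast
  then interpret prob_space M by blast
  show "0 \<le> margin i F t" "margin i F t \<le> 1" by (simp_all add: F)
qed

lemma margin_mono:
  assumes "distribution_function F" "s \<le> t"
  shows "margin i F s \<le> margin i F t"
proof -
  obtain M where "prob_space M" and F: "sets M = sets borel" "\<And>i t. margin i F t = measure M {x. x $ i \<le> t}"
    using distribution_function_measure[OF assms(1)] by blast
  then interpret prob_space M by blast
  show ?thesis using assms(2) unfolding F(2) by (intro finite_measure_mono) (auto simp: F(1))
qed

lemma distribution_function_le_margin:
  assumes "distribution_function F"
  shows "F x \<le> margin i F (x $ i)"
proof -
  obtain M where "prob_space M" and F: "sets M = sets borel" "\<And>x. F x = measure M {..x}"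
      "\<And>i t. margin i F t = measure M {x. x $ i \<le> t}"
    using distribution_function_measure[OF assms(1)] by blast
  then interpret prob_space M by blast
  show ?thesis unfolding F(2,3) by (intro finite_measure_mono) (auto simp: F(1) less_eq_vec_def)
qed

text \<open>If the i-th coordinate respects its bound, then the whole vector is at most
  \<open>x\<close> or some other coordinate exceeds its bound; the sum is the union bound for the
  latter event.\<close>

lemma margin_le_distribution_function:
  assumes "distribution_function F"
  shows "margin i F (x $ i) \<le> F x + (\<Sum>j\<in>UNIV - {i}. 1 - margin j F (x $ j))"
proof -
  obtain M where "prob_space M" and F: "sets M = sets borel" "space M = UNIV" "\<And>x. F x = measure M {..x}"
      "\<And>i t. margin i F t = measure M {x. x $ i \<le> t}"
    using distribution_function_measure[OF assms(1)] by blast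
  then interpret prob_space M by blast
  have [simp]: "{y. y $ j \<le> t} \<in> sets M" "{..y} \<in> sets M" for j t y
    by (auto simp: F(1))
  let ?B = "\<lambda>j. space M - {y. y $ j \<le> x $ j}"
  have "measure M {y. y $ i \<le> x $ i} \<le> measure M ({..x} \<union> (\<Union>j\<in>UNIV - {i}. ?B j))"
  proof (intro finite_measure_mono subsetI)
    fix y assume "y \<in> {y. y $ i \<le> x $ i}"
    then show "y \<in> {..x} \<union> (\<Union>j\<in>UNIV - {i}. ?B j)"
      by (cases "y \<le> x") (auto simp: F(2) less_eq_vec_def)
  qed (intro sets.Un sets.finite_UN sets.Diff sets.top; simp)
  also have "\<dots> \<le> measure M {..x} + measure M (\<Union>j\<in>UNIV - {i}. ?B j)"
    by (intro measure_Un_le sets.finite_UN sets.Diff) auto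
  also have "measure M (\<Union>j\<in>UNIV - {i}. ?B j) \<le> (\<Sum>j\<in>UNIV - {i}. measure M (?B j))"
    by (intro finite_measure_subadditive_finite) auto
  finally show ?thesis
    by (simp add: F(3,4) prob_compl[simplified F(2)] F(2))
qed

lemma one_minus_distribution_function_le:
  assumes "distribution_function F"
  shows "1 - F x \<le> (\<Sum>j\<in>UNIV. 1 - margin j F (x $ j))"
  \<comment> \<open>\<open>undefined\<close> stands for some index; its own term
    \<open>1 - margin\<close> completes the sum to all indices.\<close>
  using margin_le_distribution_function[OF assms, of undefined x]
  by (simp add: sum.remove[of UNIV undefined])

text \<open>The two lower orthants differ only in vectors with some coordinate between the two
  bounds, and the margins measure these slabs.\<close>

lemma distribution_function_lipschitz:
  assumes "distribution_function F"
  shows "\<bar>F x - F y\<bar> \<le> (\<Sum>j\<in>UNIV. \<bar>margin j F (x $ j) - margin j F (y $ j)\<bar>)"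
proof -
  obtain M where "prob_space M" and F: "sets M = sets borel" "space M = UNIV" "\<And>x. F x = measure M {..x}"
      "\<And>i t. margin i F t = measure M {x. x $ i \<le> t}"
    using distribution_function_measure[OF assms(1)] by blast
  then interpret prob_space M by blast
  have [simp]: "{y. y $ j \<le> t} \<in> sets M" "{..y} \<in> sets M" for j t y
    by (auto simp: F(1))
  have le: "F x - F y \<le> (\<Sum>j\<in>UNIV. \<bar>margin j F (x $ j) - margin j F (y $ j)\<bar>)" for x y
  proof -
    let ?B = "\<lambda>j. {z. z $ j \<le> x $ j} - {z. z $ j \<le> y $ j}"
    have B: "measure M (?B j) \<le> \<bar>margin j F (x $ j) - margin j F (y $ j)\<bar>" for j
    proof (cases "x $ j \<le> y $ j")
      case True
      then have "?B j = {}" by auto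
      then show ?thesis by (simp only: measure_empty abs_ge_zero)
    next
      case False
      then show ?thesis
        by (subst finite_measure_Diff) (auto simp: F(4))
    qed
    have "measure M {..x} \<le> measure M ({..y} \<union> (\<Union>j. ?B j))"
    proof (intro finite_measure_mono subsetI)
      fix z assume "z \<in> {..x}"
      then show "z \<in> {..y} \<union> (\<Union>j. ?B j)"
        by (cases "z \<le> y") (auto simp: less_eq_vec_def)
    qed (intro sets.Un sets.finite_UN sets.Diff; simp)
    also have "\<dots> \<le> measure M {..y} + measure M (\<Union>j. ?B j)"
      by (intro measure_Un_le sets.finite_UN sets.Diff) auto
    also have "measure M (\<Union>j. ?B j) \<le> (\<Sum>j\<in>UNIV. measure M (?B j))"
      by (intro finite_measure_subadditive_finite) auto
    also have "\<dots> \<le> (\<Sum>j\<in>UNIV. \<bar>margin j F (x $ j) - margin j F (y $ j)\<bar>)"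
      by (intro sum_mono B)
    finally show ?thesis by (simp add: F(3))
  qed
  show ?thesis
    using le[of x y] le[of y x] by (simp add: abs_le_iff abs_minus_commute)
qed

lemma margin_eventually_const:
  assumes "\<And>s. s \<ge> s0 \<Longrightarrow> F (\<chi> j. if j = i then t else s) = v"
  shows "margin i F t = v"
  unfolding margin_def
  by (intro tendsto_Lim tendsto_eventually eventually_at_top_linorderI[of s0] assms) auto

section \<open>Products, powers, affine images and conditioning\<close>

lemma distribution_function_mult:
  fixes F H :: "real ^ 'm \<Rightarrow> real"
  assumes "distribution_function F" "distribution_function H"
  shows "distribution_function (\<lambda>x. F x * H x)"
proof -
  obtain M where M: "prob_space M" "sets M = sets borel" "\<And>x. F x = measure M {..x}"
    using distribution_function_measure[OF assms(1)] by blast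
  obtain N where N: "prob_space N" "sets N = sets borel" "\<And>x. H x = measure N {..x}"
    using distribution_function_measure[OF assms(2)] by blast
  interpret M: prob_space M by fact
  interpret N: prob_space N by fact
  interpret MN: pair_prob_space M N ..
  \<comment> \<open>The product is the distribution function of the componentwise maximum of two
    independent vectors.\<close>
  define f :: "(real ^ 'm) \<times> (real ^ 'm) \<Rightarrow> real ^ 'm"
    where "f p = (\<chi> i. max (fst p $ i) (snd p $ i))" for p
  have "f \<in> borel \<Otimes>\<^sub>M borel \<rightarrow>\<^sub>M borel"
    unfolding f_def
    by (intro borel_measurable_vec_lambda borel_measurable_max
        measurable_compose[OF measurable_fst] measurable_compose[OF measurable_snd])
      (auto intro!: borel_measurable_continuous_onI continuous_intros)
  then have f: "f \<in> M \<Otimes>\<^sub>M N \<rightarrow>\<^sub>M borel"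
    using measurable_cong_sets[OF sets_pair_measure_cong[OF M(2) N(2)] refl] by blast
  have "F x * H x = measure (distr (M \<Otimes>\<^sub>M N) borel f) {..x}" for x
  proof -
    have "space M = UNIV" "space N = UNIV"
      using sets_eq_imp_space_eq[OF M(2)] sets_eq_imp_space_eq[OF N(2)] by auto
    then have "f -` {..x} \<inter> space (M \<Otimes>\<^sub>M N) = {..x} \<times> {..x}"
      by (auto simp: f_def less_eq_vec_def space_pair_measure)
    then have "measure (distr (M \<Otimes>\<^sub>M N) borel f) {..x} = measure (M \<Otimes>\<^sub>M N) ({..x} \<times> {..x})"
      using f by (simp add: measure_distr)
    also have "\<dots> = measure M {..x} * measure N {..x}"
      using N.emeasure_pair_measure_Times[of "{..x}" M "{..x}"]
      by (simp add: M(2) N(2) measure_def enn2real_mult)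
    finally show ?thesis by (simp add: M N)
  qed
  then show ?thesis
    unfolding distribution_function_def
    using MN.prob_space_distr[OF f] by (intro exI[of _ "distr (M \<Otimes>\<^sub>M N) borel f"]) simp
qed

lemma distribution_function_power:
  assumes "distribution_function F" "0 < n"
  shows "distribution_function (\<lambda>x. F x ^ n)"
  using assms(2)
proof (induction n rule: nat_induct_non_zero)
  case (Suc n)
  then show ?case using distribution_function_mult[OF assms(1)] by simp
qed (use assms in simp)

lemma distribution_function_affine:
  fixes F :: "real ^ 'm \<Rightarrow> real"
  assumes "distribution_function F" and c: "\<And>i. c $ i > 0"
  shows "distribution_function (\<lambda>x. F (c * x + d))"
proof -
  obtain M where M: "prob_space M" "sets M = sets borel" "space M = UNIV" "\<And>x. F x = measure M {..x}"
    using distribution_function_measure[OF assms(1)] by blast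
  define f :: "real ^ 'm \<Rightarrow> real ^ 'm" where "f y = (\<chi> i. (y $ i - d $ i) / c $ i)" for y
  have "f \<in> borel_measurable borel"
    unfolding f_def by (intro borel_measurable_vec_lambda) measurable
  then have f: "f \<in> M \<rightarrow>\<^sub>M borel"
    unfolding measurable_cong_sets[OF M(2) refl] .
  have "f -` {..x} = {..c * x + d}" for x
    using c by (auto simp: f_def less_eq_vec_def divide_le_eq mult.commute diff_le_eq)
  then have "F (c * x + d) = measure (distr M borel f) {..x}" for x
    using f by (simp add: measure_distr M)
  then show ?thesis
    unfolding distribution_function_def
    using prob_space.prob_space_distr[OF M(1) f] by (intro exI[of _ "distr M borel f"]) simp
qed

text \<open>For \<open>X\<close> distributed according to \<open>F\<close>, this is the law of the componentwise maximum of \<open>X\<close> and \<open>a\<close>, given that \<open>X \<le> a\<close> fails.\<close>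

lemma distribution_function_conditioned:
  fixes F :: "real ^ 'm \<Rightarrow> real"
  assumes "distribution_function F" and a: "F a < 1"
  shows "distribution_function (\<lambda>x. if a \<le> x then (F x - F a) / (1 - F a) else 0)"
proof -
  obtain M where M: "prob_space M" "sets M = sets borel" "space M = UNIV" "\<And>x. F x = measure M {..x}"
    using distribution_function_measure[OF assms(1)] by blast
  interpret prob_space M by fact
  have [simp]: "{..y} \<in> sets M" "- {..y} \<in> sets M" for y :: "real ^ 'm"
    by (auto simp: M(2))
  define A where "A = - {..a}"
  have [simp]: "A \<in> sets M" by (simp add: A_def)
  have A: "measure M A = 1 - F a"
    using prob_compl[of "{..a}"] by (simp add: A_def M(3,4) Compl_eq_Diff_UNIV)
  define N where "N = uniform_measure M A"
  have N: "prob_space N" "sets N = sets borel"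
    using a A by (auto simp: N_def M(2) emeasure_eq_measure intro!: prob_space_uniform_measure)
  define f :: "real ^ 'm \<Rightarrow> real ^ 'm" where "f y = (\<chi> i. max (y $ i) (a $ i))" for y
  have "f \<in> borel_measurable borel"
    unfolding f_def by (intro borel_measurable_vec_lambda) measurable
  then have f: "f \<in> N \<rightarrow>\<^sub>M borel"
    unfolding measurable_cong_sets[OF N(2) refl] .
  have "(if a \<le> x then (F x - F a) / (1 - F a) else 0) = measure (distr N borel f) {..x}" for x
  proof -
    have "f -` {..x} = (if a \<le> x then {..x} else {})"
      by (auto simp: f_def less_eq_vec_def)
    then have "measure (distr N borel f) {..x} = (if a \<le> x then measure N {..x} else 0)"
      using f by (simp add: measure_distr N_def M(3))
    moreover have "measure N {..x} = (F x - F a) / (1 - F a)" if "a \<le> x"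
    proof -
      have "measure N {..x} = measure M (A \<inter> {..x}) / measure M A"
        unfolding N_def using a A
        by (subst measure_uniform_measure) (auto simp: emeasure_eq_measure)
      moreover have "A \<inter> {..x} = {..x} - {..a}" by (auto simp: A_def)
      moreover have "measure M ({..x} - {..a}) = F x - F a"
        using that by (subst finite_measure_Diff) (auto simp: M(4))
      ultimately show ?thesis by (simp add: A)
    qed
    ultimately show ?thesis by simp
  qed
  then show ?thesis
    unfolding distribution_function_def
    using prob_space.prob_space_distr[OF N(1) f] by (intro exI[of _ "distr N borel f"]) simp
qed

section \<open>Margins and Lipschitz continuity of copulas\<close>

lemma margin_copula:
  assumes "copula C"
  shows "margin i C t = max 0 (min 1 t)"
proof -
  have df: "distribution_function C" and m: "\<And>t. 0 \<le> t \<Longrightarrow> t \<le> 1 \<Longrightarrow> margin i C t = t"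
    using assms by (auto simp: copula_def)
  consider "t < 0" | "0 \<le> t" "t \<le> 1" | "1 < t" by linarith
  then show ?thesis
  proof cases
    case 1
    then show ?thesis
      using margin_mono[OF df, of t 0 i] margin_bounds[OF df, of i t] m[of 0] by simp
  next
    case 3
    then show ?thesis
      using margin_mono[OF df, of 1 t i] margin_bounds[OF df, of i t] m[of 1] by simp
  qed (simp add: m)
qed

lemma copula_lipschitz:
  assumes "copula C"
  shows "\<bar>C x - C y\<bar> \<le> (\<Sum>j\<in>UNIV. \<bar>x $ j - y $ j\<bar>)"
proof -
  have "\<bar>C x - C y\<bar> \<le> (\<Sum>j\<in>UNIV. \<bar>margin j C (x $ j) - margin j C (y $ j)\<bar>)"
    using assms by (intro distribution_function_lipschitz) (simp add: copula_def)
  also have "\<dots> \<le> (\<Sum>j\<in>UNIV. \<bar>x $ j - y $ j\<bar>)"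
    unfolding margin_copula[OF assms] by (intro sum_mono) linarith
  finally show ?thesis .
qed

section \<open>A space-filling curve\<close>

text \<open>Schoenberg's curve reads off the binary digits of the coordinates from the ternary digits of
  the parameter. It needs a continuous wave of period 2 that is 0 on \<open>[0, 1/3]\<close> and 1 on
  \<open>[2/3, 1]\<close>.\<close>

definition step_wave :: "real \<Rightarrow> real" where
  "step_wave t = max 0 (min 1 (1/2 - cos (pi * t)))"

lemma step_wave_bounds: "0 \<le> step_wave t" "step_wave t \<le> 1"
  by (auto simp: step_wave_def)

lemma continuous_on_step_wave [continuous_intros]:
  fixes f :: "'a::t2_space \<Rightarrow> real"
  shows "continuous_on A f \<Longrightarrow> continuous_on A (\<lambda>x. step_wave (f x))"
  unfolding step_wave_def by (intro continuous_intros)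

lemma step_wave_even_add: "step_wave (2 * of_int N + u) = step_wave u"
proof -
  have "cos (pi * (2 * of_int N + u)) = cos (2 * pi * of_int N + pi * u)"
    by (simp add: algebra_simps)
  also have "\<dots> = cos (pi * u)"
    by (simp add: cos_add)
  finally show ?thesis by (simp add: step_wave_def)
qed

lemma step_wave_low: "0 \<le> u \<Longrightarrow> u \<le> 1/3 \<Longrightarrow> step_wave u = 0"
proof -
  assume "0 \<le> u" "u \<le> 1/3"
  then have "cos (pi/3) \<le> cos (pi * u)"
    by (subst cos_mono_le_eq) auto
  then show ?thesis by (simp add: step_wave_def cos_60)
qed

lemma step_wave_high: "2/3 \<le> u \<Longrightarrow> u \<le> 1 \<Longrightarrow> step_wave u = 1"
proof -
  assume u: "2/3 \<le> u" "u \<le> 1"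
  have "step_wave u = max 0 (min 1 (1/2 + cos (pi * (1 - u))))"
    by (simp add: step_wave_def right_diff_distrib)
  moreover have "cos (pi/3) \<le> cos (pi * (1 - u))"
    using u by (subst cos_mono_le_eq) auto
  ultimately show ?thesis by (simp add: cos_60)
qed

definition cantor_point :: "(nat \<Rightarrow> bool) \<Rightarrow> real" where
  "cantor_point c = (\<Sum>l. 2 * of_bool (c l) / 3 ^ Suc l)"

lemma two_thirds_geometric: "(\<lambda>l. 2 / 3 ^ Suc l :: real) sums 1"
  using sums_mult[OF geometric_sums[of "1/3 :: real"], of "2/3"] by (simp add: power_divide)

lemma cantor_sums:
  "summable (\<lambda>l. 2 * of_bool (c l) / 3 ^ Suc l :: real)"
  by (rule summable_comparison_test'[OF sums_summable[OF two_thirds_geometric]]) auto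

lemma cantor_point_bounds: "0 \<le> cantor_point c" "cantor_point c \<le> 1"
proof -
  show "0 \<le> cantor_point c"
    unfolding cantor_point_def by (intro suminf_nonneg cantor_sums) auto
  have "cantor_point c \<le> (\<Sum>l. 2 / 3 ^ Suc l)"
    unfolding cantor_point_def
    by (intro suminf_le cantor_sums sums_summable[OF two_thirds_geometric]) auto
  then show "cantor_point c \<le> 1"
    using two_thirds_geometric by (simp add: sums_iff)
qed

text \<open>Multiplication by \<open>3 ^ j\<close> moves the first \<open>j\<close> ternary digits
  in front of the point. As the digits are 0 or 2, the integer they form is even, so a wave of
  period 2 sees only the remaining digits.\<close>

lemma cantor_point_shift:
  "3 ^ j * cantor_point c = 2 * of_int (\<Sum>l<j. of_bool (c l) * 3 ^ (j - Suc l)) + cantor_point (\<lambda>l. c (l + j))"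
proof -
  have "cantor_point c = (\<Sum>l. 2 * of_bool (c (l + j)) / 3 ^ Suc (l + j)) + (\<Sum>l<j. 2 * of_bool (c l) / 3 ^ Suc l)"
    unfolding cantor_point_def by (rule suminf_split_initial_segment[OF cantor_sums])
  moreover have "3 ^ j * (\<Sum>l. 2 * of_bool (c (l + j)) / 3 ^ Suc (l + j)) = cantor_point (\<lambda>l. c (l + j))"
  proof -
    have "summable (\<lambda>l. 2 * of_bool (c (l + j)) / 3 ^ Suc (l + j) :: real)"
      using cantor_sums summable_iff_shift[of "\<lambda>l. 2 * of_bool (c l) / 3 ^ Suc l :: real" j] by blast
    from suminf_mult[OF this, of "3^j"] show ?thesis
      unfolding cantor_point_def by (simp add: power_add field_simps)
  qed
  moreover have "3 ^ j * (2 * of_bool (c l) / 3 ^ Suc l) = (2 * of_bool (c l) * 3 ^ (j - Suc l) :: real)" if "l < j" for l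
  proof -
    have "(3::real) ^ j = 3 ^ Suc l * 3 ^ (j - Suc l)"
      using that by (simp flip: power_add power_Suc)
    then show ?thesis by simp
  qed
  ultimately show ?thesis
    by (simp add: distrib_left sum_distrib_left mult.assoc del: power_Suc sum_of_bool_mult_eq)
qed

text \<open>After the shift, a leading digit 0 puts the argument into [0, 1/3] and a leading digit 2
  into [2/3, 1], where the wave is constant.\<close>

lemma step_wave_cantor_point: "step_wave (3 ^ j * cantor_point c) = of_bool (c j)"
proof -
  have "step_wave (3 ^ j * cantor_point c) = step_wave (cantor_point (\<lambda>l. c (l + j)))"
    unfolding cantor_point_shift by (rule step_wave_even_add)
  moreover have "cantor_point (\<lambda>l. c (l + j)) = 2/3 * of_bool (c j) + cantor_point (\<lambda>l. c (l + Suc j)) / 3"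
    using cantor_point_shift[of 1 "\<lambda>l. c (l + j)"] by simp
  ultimately show ?thesis
    using cantor_point_bounds[of "\<lambda>l. c (l + Suc j)"]
    by (cases "c j") (auto intro!: step_wave_low step_wave_high)
qed

definition binary_digit :: "real \<Rightarrow> nat \<Rightarrow> bool" where
  "binary_digit y k \<longleftrightarrow> odd \<lfloor>2 ^ Suc k * y\<rfloor>"

text \<open>The partial sums are the truncations of \<open>y\<close> to \<open>n\<close> binary
  places. At \<open>y = 1\<close> every \<open>binary_digit\<close> is 0, hence the strict
  bound.\<close>

lemma binary_expansion:
  assumes "0 \<le> y" "y < 1"
  shows "(\<lambda>k. of_bool (binary_digit y k) / 2 ^ Suc k) sums y"
proof -
  have part: "(\<Sum>k<n. of_bool (binary_digit y k) / 2 ^ Suc k) = real_of_int \<lfloor>2 ^ n * y\<rfloor> / 2 ^ n" for n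
  proof (induction n)
    case 0
    have "\<lfloor>y\<rfloor> = 0" using assms by (simp add: floor_eq_iff)
    then show ?case by simp
  next
    case (Suc n)
    have "\<lfloor>2 ^ n * y\<rfloor> = \<lfloor>(2 ^ Suc n * y) / of_int 2\<rfloor>" by simp
    also have "\<dots> = \<lfloor>2 ^ Suc n * y\<rfloor> div 2" by (rule floor_divide_real_eq_div) simp
    finally have "\<lfloor>2 ^ Suc n * y\<rfloor> = 2 * \<lfloor>2 ^ n * y\<rfloor> + of_bool (binary_digit y n)"
      unfolding binary_digit_def by (simp add: odd_iff_mod_2_eq_one) presburger
    then have "real_of_int \<lfloor>2 ^ Suc n * y\<rfloor> = 2 * of_int \<lfloor>2 ^ n * y\<rfloor> + of_bool (binary_digit y n)"
      by simp
    then show ?case using Suc by (simp add: field_simps)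
  qed
  have "(\<lambda>n. of_int \<lfloor>2 ^ n * y\<rfloor> / 2 ^ n) \<longlonglongrightarrow> y"
  proof (rule tendsto_sandwich)
    have "(\<lambda>n. y - (1/2) ^ n) \<longlonglongrightarrow> y - 0"
      by (intro tendsto_diff tendsto_const LIMSEQ_power_zero) auto
    then show "(\<lambda>n. y - (1/2) ^ n) \<longlonglongrightarrow> y" by simp
    show "\<forall>\<^sub>F n in sequentially. y - (1/2) ^ n \<le> of_int \<lfloor>2 ^ n * y\<rfloor> / 2 ^ n"
    proof (intro always_eventually allI)
      fix n
      have "2 ^ n * y - 1 \<le> of_int \<lfloor>2 ^ n * y\<rfloor>" by linarith
      then have "(2 ^ n * y - 1) / 2 ^ n \<le> of_int \<lfloor>2 ^ n * y\<rfloor> / 2 ^ n"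
        by (rule divide_right_mono) simp
      then show "y - (1/2) ^ n \<le> of_int \<lfloor>2 ^ n * y\<rfloor> / 2 ^ n"
        by (simp add: power_one_over diff_divide_distrib inverse_eq_divide)
    qed
    show "\<forall>\<^sub>F n in sequentially. of_int \<lfloor>2 ^ n * y\<rfloor> / 2 ^ n \<le> y"
      by (intro always_eventually allI) (simp add: field_simps)
  qed simp
  then show ?thesis unfolding sums_def part .
qed

text \<open>\<open>e\<close> is a Borel right inverse of the curve on the half-open cube, the domain
  of the binary expansions; the range of \<open>cube_map\<close> lies inside it.\<close>

lemma space_filling_curve:
  obtains \<psi> :: "real \<Rightarrow> real ^ 'm" and e :: "real ^ 'm \<Rightarrow> real"
  where "continuous_on UNIV \<psi>" "e \<in> borel_measurable borel" "\<forall>y. 0 \<le> e y \<and> e y \<le> 1"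
    "\<forall>y. (\<forall>i. 0 \<le> y $ i \<and> y $ i < 1) \<longrightarrow> \<psi> (e y) = y"
proof -
  define m where "m = CARD('m)"
  have m: "m > 0" by (simp add: m_def)
  obtain h :: "'m \<Rightarrow> nat" where h: "bij_betw h UNIV {0..<m}"
    unfolding m_def using ex_bij_betw_finite_nat[of "UNIV :: 'm set"] by auto
  define g where "g = inv h"
  have hg: "h i < m" "g (h i) = i" for i
    using h by (auto simp: g_def bij_betw_def)
  define \<psi> :: "real \<Rightarrow> real ^ 'm"
    where "\<psi> t = (\<chi> i. \<Sum>k. step_wave (3 ^ (m * k + h i) * t) / 2 ^ Suc k)" for t
  \<comment> \<open>The digits of the coordinates are interleaved: place \<open>m * k + h i\<close>
    holds the k-th binary digit of coordinate \<open>i\<close>.\<close>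
  define e :: "real ^ 'm \<Rightarrow> real"
    where "e y = cantor_point (\<lambda>j. binary_digit (y $ g (j mod m)) (j div m))" for y
  have "continuous_on UNIV \<psi>"
    unfolding \<psi>_def
  proof (intro continuous_on_vec_lambda)
    fix i
    have lim: "uniform_limit UNIV (\<lambda>n t. \<Sum>k<n. step_wave (3 ^ (m * k + h i) * t) / 2 ^ Suc k)
        (\<lambda>t. \<Sum>k. step_wave (3 ^ (m * k + h i) * t) / 2 ^ Suc k) sequentially"
    proof (rule Weierstrass_m_test)
      show "norm (step_wave (3 ^ (m * k + h i) * t) / 2 ^ Suc k) \<le> (1/2) ^ Suc k" for k t
        using step_wave_bounds[of "3 ^ (m * k + h i) * t"] by (simp add: field_simps)
      show "summable (\<lambda>k. (1/2) ^ Suc k :: real)"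
        unfolding power_Suc by (intro summable_mult summable_geometric) auto
    qed
    show "continuous_on UNIV (\<lambda>t. \<Sum>k. step_wave (3 ^ (m * k + h i) * t) / 2 ^ Suc k)"
      by (rule uniform_limit_theorem[OF _ lim])
         (auto intro!: always_eventually continuous_intros)
  qed
  moreover have "e \<in> borel_measurable borel"
    unfolding e_def cantor_point_def binary_digit_def by measurable
  moreover have "\<psi> (e y) = y" if "\<forall>i. 0 \<le> y $ i \<and> y $ i < 1" for y
    unfolding vec_eq_iff
  proof
    fix i
    have "((m * k + h i) div m) = k" "((m * k + h i) mod m) = h i" for k
      using hg(1)[of i] m by simp_all
    then have "\<psi> (e y) $ i = (\<Sum>k. of_bool (binary_digit (y $ i) k) / 2 ^ Suc k)"
      unfolding \<psi>_def e_def by (simp add: step_wave_cantor_point hg)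
    then show "\<psi> (e y) $ i = y $ i"
      using binary_expansion[of "y $ i"] that by (simp add: sums_iff)
  qed
  ultimately show ?thesis
    using that cantor_point_bounds by (auto simp: e_def)
qed

section \<open>Pointwise limits of distribution functions\<close>

definition logistic :: "real \<Rightarrow> real" where
  "logistic s = 1 / (1 + exp (- s))"

lemma logistic_bounds: "0 < logistic s" "logistic s < 1"
  by (auto simp: logistic_def field_simps add_pos_pos)

lemma logistic_le_iff: "logistic s \<le> logistic t \<longleftrightarrow> s \<le> t"
  by (simp add: logistic_def field_simps add_pos_pos)

lemma logit_le_iff: "0 < y \<Longrightarrow> y < 1 \<Longrightarrow> ln (y / (1 - y)) \<le> s \<longleftrightarrow> y \<le> logistic s"
proof -
  assume y: "0 < y" "y < 1"
  have "ln (y / (1 - y)) \<le> s \<longleftrightarrow> y / (1 - y) \<le> exp s"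
    using y by (subst exp_le_cancel_iff[symmetric]) simp
  also have "\<dots> \<longleftrightarrow> y \<le> logistic s"
    using y by (simp add: logistic_def field_simps add_pos_pos exp_minus)
  finally show ?thesis .
qed

lemma continuous_logistic [continuous_intros]:
  fixes f :: "'a::t2_space \<Rightarrow> real"
  assumes "continuous_on A f"
  shows "continuous_on A (\<lambda>x. logistic (f x))"
proof -
  have "1 + exp (- f x) \<noteq> 0" for x
    using exp_gt_zero[of "- f x"] by linarith
  then show ?thesis
    unfolding logistic_def using assms by (intro continuous_intros) auto
qed

text \<open>An order isomorphism onto the open unit cube: lower orthants correspond to lower
  orthants, and the images of all laws live in one compact set.\<close>

definition cube_map :: "real ^ 'm \<Rightarrow> real ^ 'm" where
  "cube_map x = (\<chi> i. logistic (x $ i))"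

lemma cube_map_le_iff: "cube_map x \<le> cube_map y \<longleftrightarrow> x \<le> y"
  by (simp add: cube_map_def less_eq_vec_def logistic_le_iff)

lemma continuous_on_cube_map: "continuous_on A cube_map"
  unfolding cube_map_def by (intro continuous_intros)

lemma (in prob_space) expectation_between_indicators:
  fixes f :: "'a \<Rightarrow> real"
  assumes [measurable]: "f \<in> borel_measurable M" "A \<in> events" "B \<in> events"
    and "\<And>x. indicator A x \<le> f x" and "\<And>x. f x \<le> indicator B x"
  shows "prob A \<le> expectation f" "expectation f \<le> prob B"
proof -
  have "\<bar>f x\<bar> \<le> 1" for x
    using assms(4,5)[of x] by (cases "x \<in> A"; cases "x \<in> B") auto
  then have [simp]: "integrable M f"
    by (intro integrable_const_bound[of _ 1]) auto
  have "expectation (indicator A) \<le> expectation f" "expectation f \<le> expectation (indicator B)"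
    by (intro integral_mono; use assms in \<open>simp add: integrable_indicator_iff emeasure_eq_measure\<close>)+
  then show "prob A \<le> expectation f" "expectation f \<le> prob B"
    by simp_all
qed

text \<open>Pointwise convergence alone would allow mass to escape. \<open>rcont\<close> identifies
  the weak limit with \<open>H\<close> at every point instead of at continuity points only;
  \<open>top\<close> and \<open>bot\<close> keep its mass off the upper and lower faces of the
  cube.\<close>

lemma distribution_function_limit:
  fixes F :: "nat \<Rightarrow> real ^ 'm \<Rightarrow> real" and H :: "real ^ 'm \<Rightarrow> real"
  assumes df: "\<And>n. distribution_function (F n)"
    and lim: "\<And>x. (\<lambda>n. F n x) \<longlonglongrightarrow> H x"
    and rcont: "\<And>x. ((\<lambda>h. H (x + h *\<^sub>R 1)) \<longlongrightarrow> H x) (at_right 0)"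
    and top: "((\<lambda>s. H (s *\<^sub>R 1)) \<longlongrightarrow> 1) at_top"
    and bot: "\<And>i s. ((\<lambda>t. H (\<chi> j. if j = i then t else s)) \<longlongrightarrow> 0) at_bot"
  shows "distribution_function H"
proof -
  obtain M where M: "\<And>n. prob_space (M n)" "\<And>n. sets (M n) = sets borel"
    "\<And>n x. F n x = measure (M n) {..x}"
    using df unfolding distribution_function_def by metis
  obtain \<psi> :: "real \<Rightarrow> real ^ 'm" and e where \<psi>: "continuous_on UNIV \<psi>"
    and e[measurable]: "e \<in> borel_measurable borel" and e01: "\<forall>y. 0 \<le> e y \<and> e y \<le> 1"
    and \<psi>e: "\<forall>y. (\<forall>i. 0 \<le> y $ i \<and> y $ i < 1) \<longrightarrow> \<psi> (e y) = y"
    by (rule space_filling_curve)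
  have \<psi>T: "\<psi> (e (cube_map x)) = cube_map x" for x
    by (rule \<psi>e[rule_format]) (auto simp: cube_map_def logistic_bounds less_imp_le)
  have \<psi>m[measurable]: "\<psi> \<in> borel_measurable borel"
    using \<psi> by (rule borel_measurable_continuous_onI)
  have T[measurable]: "(cube_map :: real ^ 'm \<Rightarrow> real ^ 'm) \<in> borel_measurable borel"
    by (intro borel_measurable_continuous_onI continuous_on_cube_map)
  have TM: "(\<lambda>x. e (cube_map x)) \<in> borel_measurable (M n)" for n
    unfolding measurable_cong_sets[OF M(2) refl] by measurable
  define \<nu> where "\<nu> n = distr (M n) borel (\<lambda>x. e (cube_map x))" for n
  have rd: "real_distribution (\<nu> n)" for n
    unfolding \<nu>_def by (rule prob_space.real_distribution_distr[OF M(1) TM])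
  have "tight \<nu>"
    unfolding tight_def
  proof (intro conjI allI impI)
    fix \<epsilon> :: real assume "0 < \<epsilon>"
    \<comment> \<open>\<open>-1\<close> and not 0: the interval is open on the left, and only
      \<open>0 \<le> e y\<close> is known.\<close>
    have "measure (\<nu> n) {-1<..1} = 1" for n
    proof -
      have "{x. -1 < e (cube_map x) \<and> e (cube_map x) \<le> 1} = UNIV"
        using e01 by (auto intro: less_le_trans[of _ 0])
      moreover have "space (M n) = UNIV" using sets_eq_imp_space_eq[OF M(2)] by simp
      ultimately show ?thesis
        unfolding \<nu>_def using prob_space.prob_space[OF M(1), of n] TM
        by (subst measure_distr) (auto simp: vimage_def greaterThanAtMost_def greaterThan_def atMost_def)
    qed
    then show "\<exists>a b. a < b \<and> (\<forall>n. 1 - \<epsilon> < measure (\<nu> n) {a<..b})"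
      using \<open>0 < \<epsilon>\<close> by (intro exI[of _ "-1"] exI[of _ 1]) auto
  qed (rule rd)
  from tight_imp_convergent_subsubsequence[OF this, of id]
  obtain r \<nu>' where r: "strict_mono (r :: nat \<Rightarrow> nat)" and \<nu>': "real_distribution \<nu>'"
    and conv: "weak_conv_m (\<lambda>n. \<nu> (r n)) \<nu>'"
    by (auto simp: strict_mono_id comp_def)
  interpret \<nu>': real_distribution \<nu>' by fact
  define P where "P = distr \<nu>' borel \<psi>"
  have [simp]: "sets P = sets borel" "space P = UNIV" by (simp_all add: P_def)
  interpret P: prob_space P
    unfolding P_def by (rule \<nu>'.prob_space_distr) simp
  \<comment> \<open>Weak convergence on the line is tested on \<open>f\<close> composed with
    \<open>\<psi>\<close>, which is continuous; \<open>e\<close> cancels because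
    \<open>\<psi>\<close> undoes it on the range of \<open>cube_map\<close>.\<close>
  have lim_int: "(\<lambda>k. \<integral>x. f (cube_map x) \<partial>M (r k)) \<longlonglongrightarrow> (\<integral>y. f y \<partial>P)"
    if f: "continuous_on UNIV f" and bd: "\<And>y. \<bar>f y\<bar> \<le> 1" for f :: "real ^ 'm \<Rightarrow> real"
  proof -
    have [measurable]: "f \<in> borel_measurable borel"
      using f by (rule borel_measurable_continuous_onI)
    have "continuous_on UNIV (\<lambda>t. f (\<psi> t))"
      using continuous_on_compose2[OF f \<psi>] by simp
    then have "(\<lambda>k. integral\<^sup>L (\<nu> (r k)) (\<lambda>t. f (\<psi> t))) \<longlonglongrightarrow> integral\<^sup>L \<nu>' (\<lambda>t. f (\<psi> t))"
      by (intro weak_conv_imp_integral_bdd_continuous_conv[OF rd \<nu>' conv, of _ 1])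
         (auto simp: continuous_on_eq_continuous_at bd)
    moreover have "integral\<^sup>L (\<nu> k) (\<lambda>t. f (\<psi> t)) = (\<integral>x. f (cube_map x) \<partial>M k)" for k
      unfolding \<nu>_def using TM by (subst integral_distr) (auto simp: \<psi>T)
    moreover have "integral\<^sup>L \<nu>' (\<lambda>t. f (\<psi> t)) = (\<integral>y. f y \<partial>P)"
      unfolding P_def by (subst integral_distr) auto
    ultimately show ?thesis by simp
  qed
  \<comment> \<open>A product of linear ramps separates the orthants of \<open>x\<close> and
    \<open>x + h *\<^sub>R 1\<close>, so both limits can be compared without continuity
    points.\<close>
  have between: "measure P {..cube_map x} \<le> H (x + h *\<^sub>R 1) \<and> H x \<le> measure P {..cube_map (x + h *\<^sub>R 1)}"
    if h: "h > 0" for x h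
  proof -
    define f :: "real ^ 'm \<Rightarrow> real" where "f y = (\<Prod>i\<in>UNIV. max 0 (min 1
        ((logistic (x $ i + h) - y $ i) / (logistic (x $ i + h) - logistic (x $ i)))))" for y
    have d: "0 < logistic (x $ i + h) - logistic (x $ i)" for i
      using h logistic_le_iff[of "x $ i + h" "x $ i"] by simp
    have f01: "0 \<le> f y" "f y \<le> 1" for y
      unfolding f_def by (auto intro!: prod_nonneg prod_le_1)
    have fc: "continuous_on UNIV f"
      unfolding f_def by (intro continuous_intros ballI less_imp_neq[OF d, symmetric])
    have fm[measurable]: "f \<in> borel_measurable borel"
      using fc by (rule borel_measurable_continuous_onI)
    have f1: "f y = 1" if "y \<le> cube_map x" for y
      unfolding f_def
    proof (intro prod.neutral ballI)
      fix i :: 'm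
      have "y $ i \<le> logistic (x $ i)" using that by (simp add: less_eq_vec_def cube_map_def)
      then have "1 \<le> (logistic (x $ i + h) - y $ i) / (logistic (x $ i + h) - logistic (x $ i))"
        using d[of i] by (simp add: le_divide_eq)
      then show "max 0 (min 1 ((logistic (x $ i + h) - y $ i) / (logistic (x $ i + h) - logistic (x $ i)))) = 1"
        by simp
    qed
    have f0: "f y = 0" if ny: "\<not> y \<le> cube_map (x + h *\<^sub>R 1)" for y
    proof -
      obtain i where "logistic (x $ i + h) < y $ i"
        using ny by (auto simp: less_eq_vec_def cube_map_def not_le)
      then have "(logistic (x $ i + h) - y $ i) / (logistic (x $ i + h) - logistic (x $ i)) \<le> 0"
        using d[of i] by (simp add: divide_nonpos_pos)
      then have "max 0 (min 1 ((logistic (x $ i + h) - y $ i) / (logistic (x $ i + h) - logistic (x $ i)))) = 0"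
        by simp
      then show ?thesis
        unfolding f_def by (intro prod_zero finite) blast
    qed
    have ind: "indicator {..cube_map x} y \<le> f y" "f y \<le> indicator {..cube_map (x + h *\<^sub>R 1)} y" for y
      using f01[of y] f1[of y] f0[of y] by (auto simp: indicator_def)
    have P1: "measure P {..cube_map x} \<le> (\<integral>y. f y \<partial>P)"
      and P2: "(\<integral>y. f y \<partial>P) \<le> measure P {..cube_map (x + h *\<^sub>R 1)}"
      using P.expectation_between_indicators[of f "{..cube_map x}" "{..cube_map (x + h *\<^sub>R 1)}"] ind
      by (simp_all add: measurable_cong_sets[OF \<open>sets P = sets borel\<close> refl])
    have fT: "(\<lambda>x. f (cube_map x)) \<in> borel_measurable (M n)" for n
      unfolding measurable_cong_sets[OF M(2) refl] by measurable
    have indT: "indicator {..x} z \<le> f (cube_map z)" "f (cube_map z) \<le> indicator {..x + h *\<^sub>R 1} z" for z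
      using ind[of "cube_map z"] by (simp_all add: indicator_def cube_map_le_iff)
    have M1: "F n x \<le> (\<integral>z. f (cube_map z) \<partial>M n)" for n
      unfolding M(3)
      using prob_space.expectation_between_indicators(1)[OF M(1)[of n] fT[of n], of "{..x}" "{..x + h *\<^sub>R 1}"] indT
      by (simp add: M(2))
    have M2: "(\<integral>z. f (cube_map z) \<partial>M n) \<le> F n (x + h *\<^sub>R 1)" for n
      unfolding M(3)
      using prob_space.expectation_between_indicators(2)[OF M(1)[of n] fT[of n], of "{..x}" "{..x + h *\<^sub>R 1}"] indT
      by (simp add: M(2))
    have L: "(\<lambda>k. \<integral>x. f (cube_map x) \<partial>M (r k)) \<longlonglongrightarrow> (\<integral>y. f y \<partial>P)"
      using f01 by (intro lim_int fc) (simp add: abs_le_iff)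
    have FL: "(\<lambda>k. F (r k) z) \<longlonglongrightarrow> H z" for z
      using LIMSEQ_subseq_LIMSEQ[OF lim r] by (simp add: comp_def)
    have "(\<integral>y. f y \<partial>P) \<le> H (x + h *\<^sub>R 1)"
      by (rule LIMSEQ_le[OF L FL]) (use M2 in auto)
    moreover have "H x \<le> (\<integral>y. f y \<partial>P)"
      by (rule LIMSEQ_le[OF FL L]) (use M1 in auto)
    ultimately show ?thesis using P1 P2 by linarith
  qed
  \<comment> \<open>Now \<open>h\<close> tends to 0: one inequality uses the right continuity of
    \<open>H\<close>, the other the continuity of \<open>P\<close> from above.\<close>
  have PH: "measure P {..cube_map x} = H x" for x
  proof (rule antisym)
    show "measure P {..cube_map x} \<le> H x"
      by (rule tendsto_lowerbound[OF rcont[of x]])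
         (use between in \<open>auto simp: eventually_at_right_less intro: eventually_at_rightI[of 0 1]\<close>)
    have "(\<Inter>k. {..cube_map (x + (1 / real (Suc k)) *\<^sub>R 1)}) = {..cube_map x}"
    proof (intro equalityI subsetI INT_I)
      fix y assume y: "y \<in> (\<Inter>k. {..cube_map (x + (1 / real (Suc k)) *\<^sub>R 1)})"
      have "y $ i \<le> logistic (x $ i)" for i
      proof (rule LIMSEQ_le_const)
        have "(\<lambda>k. x $ i + 1 / real (Suc k)) \<longlonglongrightarrow> x $ i + 0"
          by (intro tendsto_intros) (use LIMSEQ_inverse_real_of_nat in \<open>simp add: inverse_eq_divide\<close>)
        moreover have "isCont logistic (x $ i)"
          using continuous_logistic[OF continuous_on_id, of UNIV] by (simp add: continuous_on_eq_continuous_at)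
        ultimately show "(\<lambda>k. logistic (x $ i + 1 / real (Suc k))) \<longlonglongrightarrow> logistic (x $ i)"
          using isCont_tendsto_compose by fastforce
        show "\<exists>N. \<forall>n\<ge>N. y $ i \<le> logistic (x $ i + 1 / real (Suc n))"
          using y by (auto simp: less_eq_vec_def cube_map_def)
      qed
      then show "y \<in> {..cube_map x}" by (simp add: less_eq_vec_def cube_map_def)
    next
      fix y k assume "y \<in> {..cube_map x}"
      moreover have "cube_map x \<le> cube_map (x + (1 / real (Suc k)) *\<^sub>R 1)"
        unfolding cube_map_le_iff by (simp add: less_eq_vec_def)
      ultimately show "y \<in> {..cube_map (x + (1 / real (Suc k)) *\<^sub>R 1)}" by auto
    qed
    moreover have "decseq (\<lambda>k. {..cube_map (x + (1 / real (Suc k)) *\<^sub>R 1)})"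
      unfolding decseq_Suc_iff by (auto simp: less_eq_vec_def cube_map_def logistic_le_iff field_simps elim!: order_trans)
    ultimately have "(\<lambda>k. measure P {..cube_map (x + (1 / real (Suc k)) *\<^sub>R 1)}) \<longlonglongrightarrow> measure P {..cube_map x}"
      using P.finite_Lim_measure_decseq[of "\<lambda>k. {..cube_map (x + (1 / real (Suc k)) *\<^sub>R 1)}"] by (simp add: image_subset_iff)
    then show "H x \<le> measure P {..cube_map x}"
      by (rule LIMSEQ_le_const) (use between in auto)
  qed
  \<comment> \<open>The orthants below \<open>cube_map (s *\<^sub>R 1)\<close> avoid the upper
    faces, and by \<open>top\<close> they exhaust the mass.\<close>
  have lt1: "AE y in P. \<forall>i. y $ i < 1"
  proof -
    have B: "{y :: real ^ 'm. \<forall>i. y $ i < 1} \<in> sets P" by simp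
    have "H (s *\<^sub>R 1) \<le> measure P {y. \<forall>i. y $ i < 1}" for s
      unfolding PH[symmetric]
    proof (intro P.finite_measure_mono B subsetI)
      fix y assume "y \<in> {..cube_map (s *\<^sub>R 1) :: real ^ 'm}"
      then have "\<forall>i. y $ i \<le> logistic s" by (simp add: less_eq_vec_def cube_map_def)
      then show "y \<in> {y. \<forall>i. y $ i < 1}"
        using logistic_bounds(2)[of s] by (auto intro: le_less_trans)
    qed
    then have "1 \<le> measure P {y. \<forall>i. y $ i < 1}"
      by (intro tendsto_upperbound[OF top]) auto
    then have "measure P {y. \<forall>i. y $ i < 1} = 1"
      using P.prob_le_1 by (intro antisym)
    from P.AE_prob_1[OF this] show ?thesis by simp
  qed
  \<comment> \<open>A point with \<open>y $ i \<le> 0\<close> lies in the orthant with bound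
    \<open>t\<close> at \<open>i\<close> and \<open>s\<close> elsewhere, or outside the orthant of
    \<open>s *\<^sub>R 1\<close>. First \<open>t\<close> tends to minus infinity, then
    \<open>s\<close> to infinity.\<close>
  have gt0: "AE y in P. 0 < y $ i" for i
  proof -
    have B: "{y :: real ^ 'm. y $ i \<le> 0} \<in> sets P" by simp
    have "measure P {y. y $ i \<le> 0} \<le> 1 - H (s *\<^sub>R 1)" for s
    proof -
      have "measure P {y. y $ i \<le> 0} \<le> H (\<chi> j. if j = i then t else s) + (1 - H (s *\<^sub>R 1))" for t
      proof -
        have "measure P {y. y $ i \<le> 0}
            \<le> measure P ({..cube_map (\<chi> j. if j = i then t else s)} \<union> (space P - {..cube_map (s *\<^sub>R 1)}))"
        proof (intro P.finite_measure_mono subsetI)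
          fix y assume y: "y \<in> {y :: real ^ 'm. y $ i \<le> 0}"
          then have "y $ i \<le> logistic t" using logistic_bounds(1)[of t] by simp
          then show "y \<in> {..cube_map (\<chi> j. if j = i then t else s)} \<union> (space P - {..cube_map (s *\<^sub>R 1)})"
            by (cases "y \<le> cube_map (s *\<^sub>R 1)") (auto simp: less_eq_vec_def cube_map_def)
        qed simp
        also have "\<dots> \<le> measure P {..cube_map (\<chi> j. if j = i then t else s)} + measure P (space P - {..cube_map (s *\<^sub>R 1)})"
          by (intro measure_Un_le) auto
        also have "\<dots> = H (\<chi> j. if j = i then t else s) + (1 - H (s *\<^sub>R 1))"
          by (subst P.prob_compl) (auto simp: PH)
        finally show ?thesis .
      qed
      moreover have "((\<lambda>t. H (\<chi> j. if j = i then t else s) + (1 - H (s *\<^sub>R 1))) \<longlongrightarrow> 0 + (1 - H (s *\<^sub>R 1))) at_bot"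
        by (intro tendsto_add bot tendsto_const)
      ultimately show ?thesis
        using tendsto_lowerbound[of _ "0 + (1 - H (s *\<^sub>R 1))" at_bot] by fastforce
    qed
    moreover have "((\<lambda>s. 1 - H (s *\<^sub>R 1)) \<longlongrightarrow> 1 - 1) at_top"
      by (intro tendsto_diff top tendsto_const)
    ultimately have "measure P {y. y $ i \<le> 0} \<le> 1 - 1"
      by (intro tendsto_lowerbound[of _ _ at_top]) auto
    then have "measure P {y. y $ i \<le> 0} = 0"
      by (simp add: measure_le_0_iff)
    then have "{y. y $ i \<le> 0} \<in> null_sets P"
      using B by (auto simp: P.emeasure_eq_measure null_sets_def)
    from AE_not_in[OF this] show ?thesis by (simp add: not_le)
  qed
  \<comment> \<open>The logit in each coordinate inverts \<open>cube_map\<close> on the open cube,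
    where \<open>P\<close> is concentrated by \<open>lt1\<close> and \<open>gt0\<close>.\<close>
  define \<tau> :: "real ^ 'm \<Rightarrow> real ^ 'm" where "\<tau> y = (\<chi> i. ln (y $ i / (1 - y $ i)))" for y
  have \<tau>[measurable]: "\<tau> \<in> P \<rightarrow>\<^sub>M borel"
  proof -
    have "\<tau> \<in> borel_measurable borel"
      unfolding \<tau>_def by (intro borel_measurable_vec_lambda) measurable
    then show ?thesis by (simp add: P_def)
  qed
  show ?thesis
    unfolding distribution_function_def
  proof (intro exI conjI allI)
    show "prob_space (distr P borel \<tau>)" by (rule P.prob_space_distr) simp
    fix x
    have "measure (distr P borel \<tau>) {..x} = measure P {y. \<tau> y \<le> x}"
      by (subst measure_distr) (auto simp: vimage_def)
    also have "\<dots> = measure P {..cube_map x}"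
    proof (rule P.finite_measure_eq_AE)
      have "AE y in P. \<forall>i. 0 < y $ i"
        using gt0 by (simp add: AE_all_countable)
      with lt1 show "AE y in P. y \<in> {y. \<tau> y \<le> x} \<longleftrightarrow> y \<in> {..cube_map x}"
        by eventually_elim (auto simp: \<tau>_def cube_map_def less_eq_vec_def logit_le_iff)
      have "\<tau> -` {..x} \<inter> space P \<in> sets P"
        by (rule measurable_sets[OF \<tau>]) simp
      then show "{y. \<tau> y \<le> x} \<in> sets P"
        by (simp add: vimage_def)
    qed auto
    finally show "H x = measure (distr P borel \<tau>) {..x}" by (simp add: PH)
  qed simp
qed

section \<open>Extreme value distributions and domains of attraction\<close>

text \<open>The logarithm is squeezed by \<open>1 - 1 / c \<le> ln c \<le> c - 1\<close>; after
  multiplication by \<open>n\<close> both bounds have the same limit because \<open>c n\<close>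
  tends to 1.\<close>

lemma LIMSEQ_power_exp:
  fixes c :: "nat \<Rightarrow> real"
  assumes "(\<lambda>n. real n * (1 - c n)) \<longlonglongrightarrow> l"
  shows "(\<lambda>n. c n ^ n) \<longlonglongrightarrow> exp (- l)"
proof -
  have "(\<lambda>n. (real n * (1 - c n)) / real n) \<longlonglongrightarrow> 0"
    by (rule real_tendsto_divide_at_top[OF assms filterlim_real_sequentially])
  moreover have "\<forall>\<^sub>F n in sequentially. (real n * (1 - c n)) / real n = 1 - c n"
    using eventually_gt_at_top[of 0] by eventually_elim simp
  ultimately have "(\<lambda>n. 1 - c n) \<longlonglongrightarrow> 0"
    by (rule Lim_transform_eventually)
  from tendsto_diff[OF tendsto_const[of 1] this] have c: "c \<longlonglongrightarrow> 1" by simp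
  have pos: "\<forall>\<^sub>F n in sequentially. 0 < c n"
    using order_tendstoD(1)[OF c, of 0] by simp
  have "(\<lambda>n. real n * ln (c n)) \<longlonglongrightarrow> - l"
  proof (rule tendsto_sandwich)
    have "(\<lambda>n. - (real n * (1 - c n)) / c n) \<longlonglongrightarrow> - l / 1"
      by (intro tendsto_divide tendsto_minus assms c) simp
    then show "(\<lambda>n. - (real n * (1 - c n)) / c n) \<longlonglongrightarrow> - l" by simp
    show "(\<lambda>n. - (real n * (1 - c n))) \<longlonglongrightarrow> - l"
      by (intro tendsto_minus assms)
    show "\<forall>\<^sub>F n in sequentially. - (real n * (1 - c n)) / c n \<le> real n * ln (c n)"
      using pos
    proof eventually_elim
      case (elim n)
      have "1 - 1 / c n \<le> ln (c n)"
        using ln_le_minus_one[of "1 / c n"] elim by (simp add: ln_div)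
      then have "real n * (1 - 1 / c n) \<le> real n * ln (c n)"
        by (rule mult_left_mono) simp
      then show ?case using elim by (simp add: field_simps)
    qed
    show "\<forall>\<^sub>F n in sequentially. real n * ln (c n) \<le> - (real n * (1 - c n))"
      using pos
    proof eventually_elim
      case (elim n)
      have "real n * ln (c n) \<le> real n * (c n - 1)"
        using ln_le_minus_one[of "c n"] elim by (intro mult_left_mono) auto
      then show ?case by (simp add: algebra_simps)
    qed
  qed
  then have "(\<lambda>n. exp (real n * ln (c n))) \<longlonglongrightarrow> exp (- l)"
    by (rule tendsto_exp)
  moreover have "\<forall>\<^sub>F n in sequentially. exp (real n * ln (c n)) = c n ^ n"
    using pos by eventually_elim (simp add: exp_of_nat_mult)
  ultimately show ?thesis by (rule Lim_transform_eventually)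
qed

text \<open>The same squeeze, but \<open>c n\<close> tends to 1 for another reason:
  \<open>g > 0\<close> makes \<open>n * ln (c n)\<close> converge to a finite limit.
  \<open>nonneg\<close> excludes negative bases with even exponents.\<close>

lemma LIMSEQ_power_exp_converse:
  fixes c :: "nat \<Rightarrow> real"
  assumes lim: "(\<lambda>n. c n ^ n) \<longlonglongrightarrow> g" and g: "g > 0" and nonneg: "\<And>n. 0 \<le> c n"
  shows "(\<lambda>n. real n * (1 - c n)) \<longlonglongrightarrow> - ln g"
proof -
  have pos: "\<forall>\<^sub>F n in sequentially. 0 < c n"
    using order_tendstoD(1)[OF lim g] eventually_gt_at_top[of 0]
  proof eventually_elim
    case (elim n)
    then show ?case using nonneg[of n] by (cases "c n = 0") (auto simp: power_0_left)
  qed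
  have "(\<lambda>n. ln (c n ^ n)) \<longlonglongrightarrow> ln g"
    using g by (intro tendsto_ln lim) auto
  moreover have "\<forall>\<^sub>F n in sequentially. ln (c n ^ n) = real n * ln (c n)"
    using pos by eventually_elim (simp add: ln_realpow)
  ultimately have nln: "(\<lambda>n. real n * ln (c n)) \<longlonglongrightarrow> ln g"
    by (rule Lim_transform_eventually)
  have "(\<lambda>n. (real n * ln (c n)) / real n) \<longlonglongrightarrow> 0"
    by (rule real_tendsto_divide_at_top[OF nln filterlim_real_sequentially])
  moreover have "\<forall>\<^sub>F n in sequentially. (real n * ln (c n)) / real n = ln (c n)"
    using eventually_gt_at_top[of 0] by eventually_elim simp
  ultimately have "(\<lambda>n. exp (ln (c n))) \<longlonglongrightarrow> exp 0"
    by (intro tendsto_exp) (rule Lim_transform_eventually)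
  moreover have "\<forall>\<^sub>F n in sequentially. exp (ln (c n)) = c n"
    using pos by eventually_elim simp
  ultimately have "c \<longlonglongrightarrow> exp 0"
    by (rule Lim_transform_eventually)
  then have c: "c \<longlonglongrightarrow> 1" by simp
  show ?thesis
  proof (rule tendsto_sandwich)
    have "(\<lambda>n. - (c n * (real n * ln (c n)))) \<longlonglongrightarrow> - (1 * ln g)"
      by (intro tendsto_minus tendsto_mult c nln)
    then show "(\<lambda>n. - (c n * (real n * ln (c n)))) \<longlonglongrightarrow> - ln g" by simp
    show "(\<lambda>n. - (real n * ln (c n))) \<longlonglongrightarrow> - ln g"
      by (intro tendsto_minus nln)
    show "\<forall>\<^sub>F n in sequentially. real n * (1 - c n) \<le> - (real n * ln (c n))"
      using pos
    proof eventually_elim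
      case (elim n)
      have "real n * ln (c n) \<le> real n * (c n - 1)"
        using ln_le_minus_one[of "c n"] elim by (intro mult_left_mono) auto
      then show ?case by (simp add: algebra_simps)
    qed
    show "\<forall>\<^sub>F n in sequentially. - (c n * (real n * ln (c n))) \<le> real n * (1 - c n)"
      using pos
    proof eventually_elim
      case (elim n)
      have "1 - 1 / c n \<le> ln (c n)"
        using ln_le_minus_one[of "1 / c n"] elim by (simp add: ln_div)
      then have "c n * (1 - 1 / c n) \<le> c n * ln (c n)"
        using elim by (intro mult_left_mono) auto
      then have "- (c n * ln (c n)) \<le> 1 - c n"
        using elim by (simp add: right_diff_distrib)
      then have "real n * - (c n * ln (c n)) \<le> real n * (1 - c n)"
        by (rule mult_left_mono) simp
      then show ?case by (simp add: mult.left_commute)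
    qed
  qed
qed

section \<open>Extreme value distributions with standard negative exponential margins\<close>

definition coord :: "'m::finite \<Rightarrow> real \<Rightarrow> real ^ 'm" where
  "coord i t = (\<chi> j. if j = i then t else 0)"

lemma coord_nth: "coord i t $ j = (if j = i then t else 0)"
  by (simp add: coord_def)

lemma std_margin:
  assumes "distribution_function G" "std_neg_exp_margins G"
  shows "margin i G t = exp (min t 0)"
proof (cases "t \<le> 0")
  case False
  then show ?thesis
    using assms(2) margin_mono[OF assms(1), of 0 t i] margin_bounds[OF assms(1), of i t]
    by (auto simp: std_neg_exp_margins_def)
qed (use assms in \<open>simp add: std_neg_exp_margins_def\<close>)

text \<open>The margins reach 1 at 0, so the value of the i-th margin is already attained with zeros
  in the other coordinates.\<close>

lemma std_coord:
  assumes "distribution_function G" "std_neg_exp_margins G" "t \<le> 0"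
  shows "G (coord i t) = exp t"
  using distribution_function_le_margin[OF assms(1), of "coord i t" i]
    margin_le_distribution_function[OF assms(1), of i "coord i t"] assms(3)
  by (simp add: std_margin[OF assms(1,2)] coord_nth)

lemma std_zero:
  assumes "distribution_function G" "std_neg_exp_margins G"
  shows "G 0 = 1"
  using std_coord[OF assms, of 0] by (simp add: coord_def zero_vec_def)

text \<open>The margins force the constants of max-stability to be \<open>c $ i = 1 / n\<close> and
  \<open>d = 0\<close>.\<close>

lemma evd_power:
  fixes G :: "real ^ 'm \<Rightarrow> real"
  assumes "evd G" "std_neg_exp_margins G" "n \<ge> 1"
  shows "G ((1 / real n) *\<^sub>R x) ^ n = G x"
proof -
  have df: "distribution_function G" using assms by (simp add: evd_def)
  note mar = std_margin[OF df assms(2)] and co = std_coord[OF df assms(2)]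
  obtain c d where c: "\<And>i. c $ i > 0" and cd: "\<And>x. G (c * x + d) ^ n = G x"
    using assms(1,3) unfolding evd_def max_stable_def by metis
  \<comment> \<open>As long as \<open>d = 0\<close> is not known, affine images of axis points may
    leave the axis, and there only \<open>G \<le> margin\<close> is at hand. It is applied to the
    image of an axis point in \<open>A\<close> and to its preimage in \<open>B\<close>; together
    they give \<open>d\<close> at \<open>t = 0\<close> and then \<open>c\<close> at
    \<open>t = -1\<close>.\<close>
  have A: "t \<le> real n * (c $ i * t + d $ i)" if "t \<le> 0" for i t
  proof -
    have "exp t = G (c * coord i t + d) ^ n"
      using co[OF that] cd by simp
    also have "\<dots> \<le> margin i G (c $ i * t + d $ i) ^ n"
      using distribution_function_le_margin[OF df, of "c * coord i t + d" i] distribution_function_bounds[OF df]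
      by (intro power_mono) (auto simp: coord_nth)
    also have "\<dots> = exp (real n * min (c $ i * t + d $ i) 0)"
      by (simp add: mar exp_of_nat_mult)
    finally have "t \<le> real n * min (c $ i * t + d $ i) 0" by simp
    also have "\<dots> \<le> real n * (c $ i * t + d $ i)" by (intro mult_left_mono) auto
    finally show ?thesis .
  qed
  have B: "real n * t \<le> (t - d $ i) / c $ i" if "t \<le> 0" for i t
  proof -
    define z where "z = (\<chi> j. (coord i t $ j - d $ j) / c $ j)"
    have "c * z + d = coord i t"
      using c by (simp add: vec_eq_iff z_def less_imp_neq[symmetric])
    then have "exp (real n * t) = G z"
      using cd[of z] co[OF that, of i] by (simp add: exp_of_nat_mult)
    also have "\<dots> \<le> exp (min ((t - d $ i) / c $ i) 0)"
      using distribution_function_le_margin[OF df, of z i] by (simp add: mar z_def coord_nth)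
    finally show ?thesis by simp
  qed
  have n: "real n > 0" using assms(3) by simp
  have d: "d $ i = 0" for i
    using A[of 0 i] B[of 0 i] n c[of i] by (simp add: zero_le_mult_iff divide_le_0_iff)
  have "c $ i = 1 / real n" for i
    using A[of "-1" i] B[of "-1" i] n c[of i] by (simp add: d field_simps)
  then have "c * x + d = (1 / real n) *\<^sub>R x"
    by (simp add: vec_eq_iff d)
  then show ?thesis using cd[of x] by simp
qed

text \<open>Near 0 the union bound over the margins makes \<open>G\<close> positive, and
  \<open>evd_power\<close> carries this to \<open>x\<close>. Any \<open>n\<close> above the sum norm
  of \<open>x\<close> brings \<open>x / n\<close> close enough.\<close>

lemma evd_pos:
  fixes G :: "real ^ 'm \<Rightarrow> real"
  assumes "evd G" "std_neg_exp_margins G" "x \<le> 0"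
  shows "0 < G x"
proof -
  have df: "distribution_function G" using assms by (simp add: evd_def)
  obtain n where n: "(\<Sum>j\<in>UNIV. \<bar>x $ j\<bar>) < real n"
    using reals_Archimedean2 by blast
  have "0 \<le> (\<Sum>j\<in>UNIV. \<bar>x $ j\<bar>)" by (intro sum_nonneg) auto
  with n have n0: "0 < real n" by linarith
  have "1 - G ((1 / real n) *\<^sub>R x) \<le> (\<Sum>j\<in>UNIV. 1 - margin j G (((1 / real n) *\<^sub>R x) $ j))"
    by (rule one_minus_distribution_function_le[OF df])
  also have "\<dots> \<le> (\<Sum>j\<in>UNIV. \<bar>x $ j\<bar> / real n)"
  proof (rule sum_mono)
    fix j
    have "1 + min (x $ j / real n) 0 \<le> exp (min (x $ j / real n) 0)"
      by (rule exp_ge_add_one_self)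
    moreover have "x $ j \<le> 0" using assms(3) by (simp add: less_eq_vec_def)
    moreover have "margin j G (((1 / real n) *\<^sub>R x) $ j) = exp (min (x $ j / real n) 0)"
      by (simp add: std_margin[OF df assms(2)])
    moreover have "min (x $ j / real n) 0 = - (\<bar>x $ j\<bar> / real n)"
      using n0 \<open>x $ j \<le> 0\<close> by (simp add: min_def divide_le_0_iff)
    ultimately show "1 - margin j G (((1 / real n) *\<^sub>R x) $ j) \<le> \<bar>x $ j\<bar> / real n"
      by linarith
  qed
  also have "\<dots> < 1"
    using n n0 by (simp add: sum_divide_distrib[symmetric])
  finally have "0 < G ((1 / real n) *\<^sub>R x) ^ n" by simp
  then show ?thesis using evd_power[OF assms(1,2), of n x] n0 by simp
qed

section \<open>Tail limits and the domain of attraction\<close>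

definition tail_limit :: "(real ^ 'm \<Rightarrow> real) \<Rightarrow> (real ^ 'm \<Rightarrow> real) \<Rightarrow> bool" where
  "tail_limit C L \<longleftrightarrow> (\<forall>x\<le>0. (\<lambda>n. real n * (1 - C (1 + (1 / real n) *\<^sub>R x))) \<longlonglongrightarrow> L x)"

lemma tail_limit_unique:
  "tail_limit C L \<Longrightarrow> tail_limit C L' \<Longrightarrow> x \<le> 0 \<Longrightarrow> L x = L' x"
  unfolding tail_limit_def by (blast intro: LIMSEQ_unique)

lemma domain_of_attraction_tail_limit:
  fixes C :: "real ^ 'm \<Rightarrow> real"
  assumes "copula C" "evd G" "std_neg_exp_margins G" "in_domain_of_attraction C G"
  shows "tail_limit C (\<lambda>x. - ln (G x))"
proof -
  have dfC: "distribution_function C" using assms by (simp add: copula_def)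
  have dfG: "distribution_function G" using assms by (simp add: evd_def)
  obtain a b where lim: "\<And>x. (\<lambda>n. C (a n * x + b n) ^ n) \<longlonglongrightarrow> G x"
    using assms(4) unfolding in_domain_of_attraction_def by blast
  have tail: "(\<lambda>n. real n * (1 - C (a n * x + b n))) \<longlonglongrightarrow> - ln (G x)" if "x \<le> 0" for x
    by (rule LIMSEQ_power_exp_converse[OF lim evd_pos[OF assms(2,3) that]])
       (rule distribution_function_bounds[OF dfC])
  \<comment> \<open>At \<open>x = 0\<close> the tail limit is \<open>- ln 1 = 0\<close>, and each
    margin is at least \<open>C\<close>.\<close>
  have m0: "(\<lambda>n. real n * (1 - margin j C (b n $ j))) \<longlonglongrightarrow> 0" for j
  proof (rule tendsto_sandwich)
    show "\<forall>\<^sub>F n in sequentially. 0 \<le> real n * (1 - margin j C (b n $ j))"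
      using margin_bounds[OF dfC] by simp
    show "\<forall>\<^sub>F n in sequentially. real n * (1 - margin j C (b n $ j)) \<le> real n * (1 - C (a n * 0 + b n))"
      using distribution_function_le_margin[OF dfC] by (intro always_eventually allI mult_left_mono) auto
    show "(\<lambda>n. real n * (1 - C (a n * 0 + b n))) \<longlonglongrightarrow> 0"
      using tail[of 0] std_zero[OF dfG assms(3)] by simp
  qed simp
  \<comment> \<open>On the i-th axis the other coordinates contribute only the vanishing terms of
    \<open>m0\<close>, so the joint tail and the marginal tail have the same limit.\<close>
  have m: "(\<lambda>n. real n * (1 - margin i C (a n $ i * t + b n $ i))) \<longlonglongrightarrow> - t" if t: "t < 0" for i t
  proof (rule tendsto_sandwich)
    have cn: "coord i t \<le> 0" using t by (simp add: less_eq_vec_def coord_nth)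
    have c: "(\<lambda>n. real n * (1 - C (a n * coord i t + b n))) \<longlonglongrightarrow> - t"
      using tail[OF cn] t by (simp add: std_coord[OF dfG assms(3)])
    have "(\<lambda>n. real n * (1 - C (a n * coord i t + b n)) - (\<Sum>j\<in>UNIV - {i}. real n * (1 - margin j C (b n $ j))))
        \<longlonglongrightarrow> - t - (\<Sum>j\<in>UNIV - {i}. 0)"
      by (intro tendsto_diff tendsto_sum c m0)
    then show "(\<lambda>n. real n * (1 - C (a n * coord i t + b n)) - (\<Sum>j\<in>UNIV - {i}. real n * (1 - margin j C (b n $ j)))) \<longlonglongrightarrow> - t"
      by simp
    show "(\<lambda>n. real n * (1 - C (a n * coord i t + b n))) \<longlonglongrightarrow> - t"
      by (rule c)
    show "\<forall>\<^sub>F n in sequentially. real n * (1 - margin i C (a n $ i * t + b n $ i)) \<le> real n * (1 - C (a n * coord i t + b n))"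
    proof (intro always_eventually allI mult_left_mono)
      fix n
      show "1 - margin i C (a n $ i * t + b n $ i) \<le> 1 - C (a n * coord i t + b n)"
        using distribution_function_le_margin[OF dfC, of "a n * coord i t + b n" i] by (simp add: coord_nth)
    qed simp
    show "\<forall>\<^sub>F n in sequentially. real n * (1 - C (a n * coord i t + b n)) - (\<Sum>j\<in>UNIV - {i}. real n * (1 - margin j C (b n $ j)))
        \<le> real n * (1 - margin i C (a n $ i * t + b n $ i))"
    proof (intro always_eventually allI)
      fix n
      have "margin i C (a n $ i * t + b n $ i) \<le> C (a n * coord i t + b n) + (\<Sum>j\<in>UNIV - {i}. 1 - margin j C (b n $ j))"
        using margin_le_distribution_function[OF dfC, of i "a n * coord i t + b n"] by (simp add: coord_nth)
      then have "real n * (1 - C (a n * coord i t + b n) - (\<Sum>j\<in>UNIV - {i}. 1 - margin j C (b n $ j)))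
          \<le> real n * (1 - margin i C (a n $ i * t + b n $ i))"
        by (intro mult_left_mono) auto
      then show "real n * (1 - C (a n * coord i t + b n)) - (\<Sum>j\<in>UNIV - {i}. real n * (1 - margin j C (b n $ j)))
        \<le> real n * (1 - margin i C (a n $ i * t + b n $ i))"
        by (simp add: right_diff_distrib sum_distrib_left)
    qed
  qed
  \<comment> \<open>\<open>t < 0\<close> makes the limit positive, so eventually the margin lies
    strictly between 0 and 1, where it is the identity.\<close>
  have u: "(\<lambda>n. real n * (1 - (a n $ i * t + b n $ i))) \<longlonglongrightarrow> - t" if t: "t < 0" for i t
  proof -
    let ?u = "\<lambda>n. a n $ i * t + b n $ i"
    have "(\<lambda>n. (real n * (1 - margin i C (?u n))) / real n) \<longlonglongrightarrow> 0"
      by (rule real_tendsto_divide_at_top[OF m[OF t] filterlim_real_sequentially])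
    then have "\<forall>\<^sub>F n in sequentially. (real n * (1 - margin i C (?u n))) / real n < 1"
      by (rule order_tendstoD) simp
    moreover have "\<forall>\<^sub>F n in sequentially. real n * (1 - margin i C (?u n)) > 0"
      using m[OF t] t by (intro order_tendstoD) auto
    ultimately have "\<forall>\<^sub>F n in sequentially. real n * (1 - margin i C (?u n)) = real n * (1 - ?u n)"
      using eventually_gt_at_top[of 0]
    proof eventually_elim
      case (elim n)
      then have "0 < margin i C (?u n)" "margin i C (?u n) < 1"
        by (auto simp: zero_less_mult_iff)
      then show ?case unfolding margin_copula[OF assms(1)] by (simp add: min_def max_def split: if_splits)
    qed
    then show ?thesis by (rule Lim_transform_eventually[OF m[OF t]])
  qed
  \<comment> \<open>\<open>u\<close> excludes \<open>t = 0\<close>, so slope and intercept are read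
    off from \<open>-1\<close> and \<open>-2\<close>.\<close>
  have an: "(\<lambda>n. real n * a n $ i) \<longlonglongrightarrow> 1" for i
  proof -
    have "(\<lambda>n. real n * (1 - (a n $ i * (-2) + b n $ i)) - real n * (1 - (a n $ i * (-1) + b n $ i))) \<longlonglongrightarrow> - (-2) - - (-1)"
      by (intro tendsto_diff u) auto
    then show ?thesis by (simp add: algebra_simps)
  qed
  have bn: "(\<lambda>n. real n * (1 - b n $ i)) \<longlonglongrightarrow> 0" for i
  proof -
    have "(\<lambda>n. real n * (1 - (a n $ i * (-1) + b n $ i)) - real n * a n $ i) \<longlonglongrightarrow> - (-1) - 1"
      by (intro tendsto_diff u an) auto
    then show ?thesis by (simp add: algebra_simps)
  qed
  show ?thesis
    unfolding tail_limit_def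
  proof (intro allI impI)
    fix x :: "real ^ 'm" assume x: "x \<le> 0"
    have diff: "(\<lambda>n. real n * C (a n * x + b n) - real n * C (1 + (1 / real n) *\<^sub>R x)) \<longlonglongrightarrow> 0"
    proof (rule Lim_null_comparison)
      have "(\<lambda>n. \<Sum>i\<in>UNIV. \<bar>(real n * a n $ i) * x $ i - real n * (1 - b n $ i) - x $ i\<bar>)
          \<longlonglongrightarrow> (\<Sum>i\<in>UNIV. \<bar>1 * x $ i - 0 - x $ i\<bar>)"
        by (intro tendsto_intros an bn)
      then show "(\<lambda>n. \<Sum>i\<in>UNIV. \<bar>(real n * a n $ i) * x $ i - real n * (1 - b n $ i) - x $ i\<bar>) \<longlonglongrightarrow> 0"
        by simp
      show "\<forall>\<^sub>F n in sequentially. norm (real n * C (a n * x + b n) - real n * C (1 + (1 / real n) *\<^sub>R x))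
          \<le> (\<Sum>i\<in>UNIV. \<bar>(real n * a n $ i) * x $ i - real n * (1 - b n $ i) - x $ i\<bar>)"
        using eventually_gt_at_top[of 0]
      proof eventually_elim
        case (elim n)
        have "norm (real n * C (a n * x + b n) - real n * C (1 + (1 / real n) *\<^sub>R x))
            = real n * \<bar>C (a n * x + b n) - C (1 + (1 / real n) *\<^sub>R x)\<bar>"
          by (simp add: abs_mult flip: right_diff_distrib)
        also have "\<dots> \<le> real n * (\<Sum>i\<in>UNIV. \<bar>(a n * x + b n) $ i - (1 + (1 / real n) *\<^sub>R x) $ i\<bar>)"
          by (intro mult_left_mono copula_lipschitz assms) auto
        also have "\<dots> = (\<Sum>i\<in>UNIV. \<bar>real n * ((a n * x + b n) $ i - (1 + (1 / real n) *\<^sub>R x) $ i)\<bar>)"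
          by (simp add: sum_distrib_left abs_mult)
        also have "\<dots> = (\<Sum>i\<in>UNIV. \<bar>(real n * a n $ i) * x $ i - real n * (1 - b n $ i) - x $ i\<bar>)"
          using elim by (intro sum.cong refl arg_cong[where f = abs]) (simp add: field_simps)
        finally show ?case .
      qed
    qed
    have "(\<lambda>n. real n * (1 - C (a n * x + b n)) + (real n * C (a n * x + b n) - real n * C (1 + (1 / real n) *\<^sub>R x)))
        \<longlonglongrightarrow> - ln (G x) + 0"
      by (intro tendsto_add tail x diff)
    then show "(\<lambda>n. real n * (1 - C (1 + (1 / real n) *\<^sub>R x))) \<longlonglongrightarrow> - ln (G x)"
      by (simp add: algebra_simps)
  qed
qed

section \<open>The limit is a norm\<close>

text \<open>Otherwise \<open>d k\<close> would eventually exceed a positive multiple of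
  \<open>1 / k\<close>, and its partial sums would be unbounded.\<close>

lemma harmonic_rate_nonpos:
  fixes d :: "nat \<Rightarrow> real"
  assumes lim: "(\<lambda>k. real k * d k) \<longlonglongrightarrow> \<Delta>" and bound: "\<And>n. (\<Sum>k<n. d k) \<le> B"
  shows "\<Delta> \<le> 0"
proof (rule ccontr)
  assume "\<not> \<Delta> \<le> 0"
  then have \<Delta>: "0 < \<Delta>" "\<Delta> / 2 < \<Delta>" by auto
  have "\<forall>\<^sub>F k in sequentially. \<Delta> / 2 < real k * d k"
    using order_tendstoD(1)[OF lim \<Delta>(2)] .
  then obtain N where N: "\<And>k. k \<ge> N \<Longrightarrow> \<Delta> / 2 < real k * d k"
    unfolding eventually_sequentially by blast
  have le: "\<Delta> / 2 * inverse (real k) \<le> d k" if "k \<ge> N" for k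
    using N[OF that] \<Delta> by (cases "k = 0") (auto simp: field_simps)
  have "summable (\<lambda>k. \<Delta> / 2 * inverse (real (k + N)))"
  proof (rule summableI_nonneg_bounded)
    fix n
    have "(\<Sum>k<n. \<Delta> / 2 * inverse (real (k + N))) \<le> (\<Sum>k<n. d (k + N))"
      by (intro sum_mono le) simp
    also have "\<dots> = (\<Sum>k<n + N. d k) - (\<Sum>k<N. d k)"
      by (induction n) auto
    also have "\<dots> \<le> B - (\<Sum>k<N. d k)" using bound by simp
    finally show "(\<Sum>k<n. \<Delta> / 2 * inverse (real (k + N))) \<le> B - (\<Sum>k<N. d k)" .
  qed (use \<Delta> in auto)
  then have "summable (\<lambda>k. inverse (real (k + N)))"
    using \<Delta> by (subst (asm) summable_cmult_iff) auto
  then have "summable (\<lambda>k. inverse (real k))"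
    by (subst (asm) summable_iff_shift)
  then show False using not_summable_harmonic[where 'a = real] by simp
qed

text \<open>Let \<open>p\<close> and \<open>q\<close> be least with \<open>P p\<close> and
  \<open>Q q\<close>. Then \<open>P\<close> and \<open>Q\<close> fail at least \<open>p - 1\<close>
  and \<open>q - 1\<close> times, while \<open>R\<close> holds from \<open>p + q\<close> on and so
  fails at most \<open>p + q - 1\<close> times; the additive 1 is the price of rounding. If
  \<open>P\<close> or \<open>Q\<close> fails throughout, the bound is trivial.\<close>

lemma card_failures_le:
  fixes P Q R :: "nat \<Rightarrow> bool"
  assumes add: "\<And>p q. p \<ge> 1 \<Longrightarrow> q \<ge> 1 \<Longrightarrow> P p \<Longrightarrow> Q q \<Longrightarrow> R (p + q)"
    and up: "\<And>p q. p \<ge> 1 \<Longrightarrow> p \<le> q \<Longrightarrow> R p \<Longrightarrow> R q"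
  shows "card {k\<in>{1..n}. \<not> R k} \<le> card {k\<in>{1..n}. \<not> P k} + card {k\<in>{1..n}. \<not> Q k} + 1"
proof -
  have "card {k\<in>{1..n}. \<not> R k} \<le> card {1..n}"
    by (intro card_mono) auto
  then have all: "card {k\<in>{1..n}. \<not> R k} \<le> n" by simp
  have least: "(\<exists>p\<ge>1. S p \<and> p \<le> card {k\<in>{1..n}. \<not> S k} + 1) \<or> card {k\<in>{1..n}. \<not> S k} = n"
    for S :: "nat \<Rightarrow> bool"
  proof (cases "\<exists>k\<ge>1. S k \<and> k \<le> n")
    case True
    define p where "p = (LEAST k. k \<ge> 1 \<and> S k \<and> k \<le> n)"
    have p: "p \<ge> 1 \<and> S p \<and> p \<le> n"
      unfolding p_def by (rule LeastI_ex) (use True in blast)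
    have "\<not> S k" if "1 \<le> k" "k < p" for k
      using not_less_Least[of k "\<lambda>k. k \<ge> 1 \<and> S k \<and> k \<le> n"] that p by (auto simp: p_def)
    then have "card {1..<p} \<le> card {k\<in>{1..n}. \<not> S k}"
      using p by (intro card_mono) auto
    then show ?thesis using p by auto
  next
    case False
    then have "{k\<in>{1..n}. \<not> S k} = {1..n}" by auto
    then show ?thesis by simp
  qed
  from least[of P] least[of Q] show ?thesis
  proof (elim disjE exE conjE)
    fix p q assume p: "1 \<le> p" "P p" "p \<le> card {k\<in>{1..n}. \<not> P k} + 1"
      and q: "1 \<le> q" "Q q" "q \<le> card {k\<in>{1..n}. \<not> Q k} + 1"
    have "R k" if "p + q \<le> k" for k
      using up[OF _ that add[OF p(1) q(1) p(2) q(2)]] p by simp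
    then have "card {k\<in>{1..n}. \<not> R k} \<le> card {1..<p + q}"
      by (intro card_mono) (auto simp: not_le[symmetric])
    then show ?thesis using p q by simp
  qed (use all in auto)
qed

text \<open>With \<open>U\<close> distributed according to \<open>C\<close> and \<open>X = 1 / (1 - U)\<close>, the sums are
  \<open>\<Sum>k. P (max\<^sub>i \<bar>x\<^sub>i\<bar> X\<^sub>i > k)\<close>, that is, expectations of a truncated integer rounding of
  \<open>max\<^sub>i \<bar>x\<^sub>i\<bar> X\<^sub>i\<close>, which is subadditive in \<open>x\<close>.\<close>

lemma sum_tail_subadditive:
  fixes C :: "real ^ 'm \<Rightarrow> real"
  assumes "distribution_function C" and x: "x \<le> 0" and y: "y \<le> 0"
  defines "\<phi> \<equiv> \<lambda>z k. 1 - C (1 + (1 / real k) *\<^sub>R z)"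
  shows "(\<Sum>k=1..n. \<phi> (x + y) k) \<le> (\<Sum>k=1..n. \<phi> x k) + (\<Sum>k=1..n. \<phi> y k) + 1"
proof -
  obtain M where "prob_space M" and M: "sets M = sets borel" "space M = UNIV" "\<And>x. C x = measure M {..x}"
    using distribution_function_measure[OF assms(1)] by blast
  then interpret prob_space M by blast
  define A where "A z k = - {..1 + (1 / real k) *\<^sub>R z}" for z :: "real ^ 'm" and k
  have A[measurable]: "A z k \<in> sets M" for z k
    by (auto simp: A_def M(1))
  have \<phi>: "\<phi> z k = measure M (A z k)" for z k
    using prob_compl[of "{..1 + (1 / real k) *\<^sub>R z}"] by (simp add: \<phi>_def A_def M Compl_eq_Diff_UNIV)
  have sum: "(\<Sum>k=1..n. \<phi> z k) = expectation (\<lambda>u. \<Sum>k=1..n. indicator (A z k) u)" for z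
    unfolding \<phi> by (subst Bochner_Integration.integral_sum) (auto simp: emeasure_eq_measure)
  have int: "integrable M (\<lambda>u. \<Sum>k=1..n. indicator (A z k) u :: real)" for z
    by (intro Bochner_Integration.integrable_sum) (auto simp: emeasure_eq_measure)
  have pointwise: "(\<Sum>k=1..n. indicator (A (x + y) k) u)
      \<le> (\<Sum>k=1..n. indicator (A x k) u) + (\<Sum>k=1..n. indicator (A y k) u) + (1::real)" for u
  proof -
    \<comment> \<open>Multiplied out, the condition has no singularity at \<open>u $ i = 1\<close>,
      and the inequalities for \<open>p\<close> and \<open>q\<close> simply add up.\<close>
    have good: "u \<notin> A z k \<longleftrightarrow> (\<forall>i. - z $ i \<le> real k * (1 - u $ i))" if "1 \<le> k" for z k
      using that by (auto simp: A_def less_eq_vec_def field_simps)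
    have card: "(\<Sum>k=1..n. indicator (A z k) u :: real) = card {k\<in>{1..n}. \<not> u \<notin> A z k}" for z
      by (simp add: indicator_def Int_def)
    have "card {k\<in>{1..n}. \<not> u \<notin> A (x + y) k} \<le> card {k\<in>{1..n}. \<not> u \<notin> A x k} + card {k\<in>{1..n}. \<not> u \<notin> A y k} + 1"
    proof (rule card_failures_le)
      fix p q :: nat assume pq: "1 \<le> p" "1 \<le> q" "u \<notin> A x p" "u \<notin> A y q"
      show "u \<notin> A (x + y) (p + q)"
        unfolding good[OF trans_le_add1[OF pq(1)]]
      proof
        fix i
        have "- x $ i \<le> real p * (1 - u $ i)" "- y $ i \<le> real q * (1 - u $ i)"
          using pq good by blast+
        then show "- (x + y) $ i \<le> real (p + q) * (1 - u $ i)"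
          by (simp add: distrib_right)
      qed
    next
      fix p q :: nat assume pq: "1 \<le> p" "p \<le> q" "u \<notin> A (x + y) p"
      have "- (x + y) $ i \<le> real q * (1 - u $ i)" for i
      proof -
        have "- (x + y) $ i \<le> real p * (1 - u $ i)" using good[of p "x + y"] pq by blast
        \<comment> \<open>This sign forces \<open>u $ i \<le> 1\<close>, so that passing from
          \<open>p\<close> to \<open>q\<close> enlarges the right-hand side.\<close>
        moreover have "0 \<le> - (x + y) $ i"
        proof -
          have "x $ i \<le> 0" "y $ i \<le> 0" using x y by (auto simp: less_eq_vec_def)
          then show ?thesis by simp
        qed
        ultimately have "0 \<le> real p * (1 - u $ i)" by linarith
        then have "0 \<le> 1 - u $ i" using pq(1) by (simp add: zero_le_mult_iff)
        then have "real p * (1 - u $ i) \<le> real q * (1 - u $ i)"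
          using pq(2) by (intro mult_right_mono) auto
        with \<open>- (x + y) $ i \<le> real p * (1 - u $ i)\<close> show ?thesis by linarith
      qed
      then show "u \<notin> A (x + y) q" using good[of q "x + y"] pq by simp
    qed
    then show ?thesis unfolding card by linarith
  qed
  have "(\<Sum>k=1..n. \<phi> (x + y) k)
      \<le> expectation (\<lambda>u. (\<Sum>k=1..n. indicator (A x k) u) + (\<Sum>k=1..n. indicator (A y k) u) + 1)"
    unfolding sum using pointwise by (intro integral_mono Bochner_Integration.integrable_add int) auto
  also have "\<dots> = (\<Sum>k=1..n. \<phi> x k) + (\<Sum>k=1..n. \<phi> y k) + 1"
    unfolding sum using int prob_space by (simp add: Bochner_Integration.integrable_add)
  finally show ?thesis .
qed

section \<open>The tail limit of a copula as a function on the negative orthant\<close>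

locale copula_tail =
  fixes C L :: "real ^ 'm \<Rightarrow> real"
  assumes copula: "copula C" and tail: "tail_limit C L"
begin

lemma df: "distribution_function C"
  using copula by (simp add: copula_def)

lemma lim: "x \<le> 0 \<Longrightarrow> (\<lambda>n. real n * (1 - C (1 + (1 / real n) *\<^sub>R x))) \<longlonglongrightarrow> L x"
  using tail by (simp add: tail_limit_def)

lemma C_one: "C 1 = 1"
  using one_minus_distribution_function_le[OF df, of 1] distribution_function_bounds[OF df, of 1]
  by (simp add: margin_copula[OF copula])

lemma L_zero: "L 0 = 0"
  using lim[of 0] by (simp add: C_one LIMSEQ_const_iff)

lemma L_lipschitz:
  assumes "x \<le> 0" "y \<le> 0"
  shows "\<bar>L x - L y\<bar> \<le> (\<Sum>j\<in>UNIV. \<bar>x $ j - y $ j\<bar>)"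
proof (rule LIMSEQ_le_const2)
  show "(\<lambda>n. \<bar>real n * (1 - C (1 + (1 / real n) *\<^sub>R x)) - real n * (1 - C (1 + (1 / real n) *\<^sub>R y))\<bar>) \<longlonglongrightarrow> \<bar>L x - L y\<bar>"
    using assms by (intro tendsto_rabs tendsto_diff lim)
  have "\<bar>real n * (1 - C (1 + (1 / real n) *\<^sub>R x)) - real n * (1 - C (1 + (1 / real n) *\<^sub>R y))\<bar>
      \<le> (\<Sum>j\<in>UNIV. \<bar>x $ j - y $ j\<bar>)" if "n \<ge> 1" for n
  proof -
    have "\<bar>real n * (1 - C (1 + (1 / real n) *\<^sub>R x)) - real n * (1 - C (1 + (1 / real n) *\<^sub>R y))\<bar>
        = real n * \<bar>C (1 + (1 / real n) *\<^sub>R x) - C (1 + (1 / real n) *\<^sub>R y)\<bar>"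
      by (simp add: abs_mult abs_minus_commute flip: right_diff_distrib)
    also have "\<dots> \<le> real n * (\<Sum>j\<in>UNIV. \<bar>(1 + (1 / real n) *\<^sub>R x) $ j - (1 + (1 / real n) *\<^sub>R y) $ j\<bar>)"
      by (intro mult_left_mono copula_lipschitz copula) simp
    also have "\<dots> = real n * ((\<Sum>j\<in>UNIV. \<bar>x $ j - y $ j\<bar>) / real n)"
      by (simp add: sum_divide_distrib flip: diff_divide_distrib)
    also have "\<dots> = (\<Sum>j\<in>UNIV. \<bar>x $ j - y $ j\<bar>)"
      using that by simp
    finally show ?thesis .
  qed
  then show "\<exists>N. \<forall>n\<ge>N. \<bar>real n * (1 - C (1 + (1 / real n) *\<^sub>R x)) - real n * (1 - C (1 + (1 / real n) *\<^sub>R y))\<bar>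
      \<le> (\<Sum>j\<in>UNIV. \<bar>x $ j - y $ j\<bar>)" by blast
qed

lemma L_antimono:
  assumes "x \<le> y" "y \<le> 0"
  shows "L y \<le> L x"
proof (rule LIMSEQ_le)
  show "(\<lambda>n. real n * (1 - C (1 + (1 / real n) *\<^sub>R y))) \<longlonglongrightarrow> L y" using assms by (intro lim)
  show "(\<lambda>n. real n * (1 - C (1 + (1 / real n) *\<^sub>R x))) \<longlonglongrightarrow> L x" using assms by (intro lim) auto
  have "real n * (1 - C (1 + (1 / real n) *\<^sub>R y)) \<le> real n * (1 - C (1 + (1 / real n) *\<^sub>R x))" for n
    using assms by (intro mult_left_mono diff_left_mono distribution_function_mono[OF df])
      (auto simp: less_eq_vec_def divide_right_mono)
  then show "\<exists>N. \<forall>n\<ge>N. real n * (1 - C (1 + (1 / real n) *\<^sub>R y)) \<le> real n * (1 - C (1 + (1 / real n) *\<^sub>R x))"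
    by blast
qed

text \<open>A single margin already accounts for this much of the tail. The bound makes the norm
  definite and sends \<open>G\<close> to 0 at minus infinity.\<close>

lemma L_lower:
  assumes "x \<le> 0"
  shows "- x $ i \<le> L x"
proof (rule LIMSEQ_le_const[OF lim[OF assms]])
  \<comment> \<open>From this \<open>N\<close> on, \<open>1 + x $ i / n\<close> lies in the unit
    interval, where the margin is the identity.\<close>
  obtain N :: nat where N: "- x $ i \<le> real N" using real_arch_simple by blast
  have "- x $ i \<le> real n * (1 - C (1 + (1 / real n) *\<^sub>R x))" if "n \<ge> max N 1" for n
  proof -
    have n: "1 \<le> real n" "- x $ i \<le> real n" using that N by auto
    have "C (1 + (1 / real n) *\<^sub>R x) \<le> max 0 (min 1 (1 + x $ i / real n))"
      using distribution_function_le_margin[OF df, of "1 + (1 / real n) *\<^sub>R x" i] by (simp add: margin_copula[OF copula])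
    also have "\<dots> = 1 + x $ i / real n"
    proof -
      have "x $ i \<le> 0" using assms by (simp add: less_eq_vec_def)
      then have "x $ i / real n \<le> 0" "- 1 \<le> x $ i / real n"
        using n by (auto simp: divide_le_0_iff field_simps)
      then show ?thesis by simp
    qed
    finally have "real n * (- (x $ i / real n)) \<le> real n * (1 - C (1 + (1 / real n) *\<^sub>R x))"
      using n by (intro mult_left_mono) auto
    then show ?thesis using n by simp
  qed
  then show "\<exists>N. \<forall>n\<ge>N. - x $ i \<le> real n * (1 - C (1 + (1 / real n) *\<^sub>R x))" by blast
qed

lemma L_coord:
  assumes "t \<le> 0"
  shows "L (coord i t) = - t"
proof (rule antisym)
  have c: "coord i t \<le> 0" using assms by (simp add: less_eq_vec_def coord_nth)
  show "- t \<le> L (coord i t)" using L_lower[OF c, of i] by (simp add: coord_nth)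
  have "\<bar>L (coord i t) - L 0\<bar> \<le> (\<Sum>j\<in>UNIV. \<bar>coord i t $ j - 0 $ j\<bar>)"
    by (rule L_lipschitz[OF c]) simp
  also have "\<dots> = (\<Sum>j\<in>UNIV. if j = i then \<bar>t\<bar> else 0)"
    by (intro sum.cong) (auto simp: coord_nth)
  also have "\<dots> = \<bar>t\<bar>" by simp
  finally show "L (coord i t) \<le> - t" using assms by (simp add: L_zero)
qed

text \<open>Homogeneity and uniformity need real parameters. By monotonicity along the ray,
  \<open>t\<close> can be enclosed between \<open>1 / (N t + 1)\<close> and \<open>1 / N t\<close>,
  where \<open>N t\<close> is the integer part of \<open>1 / t\<close>.\<close>

lemma lim_at_right:
  assumes x: "x \<le> 0"
  shows "((\<lambda>t. (1 - C (1 + t *\<^sub>R x)) / t) \<longlongrightarrow> L x) (at_right 0)"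
proof (rule tendsto_sandwich)
  define \<phi> where "\<phi> t = 1 - C (1 + t *\<^sub>R x)" for t
  have mono: "\<phi> s \<le> \<phi> t" if "s \<le> t" for s t
    unfolding \<phi>_def using that x
    by (intro diff_left_mono distribution_function_mono[OF df]) (auto simp: less_eq_vec_def intro: mult_right_mono_neg)
  have nonneg: "0 \<le> \<phi> t" for t
    unfolding \<phi>_def using distribution_function_bounds[OF df] by simp
  define N where "N t = nat \<lfloor>inverse t\<rfloor>" for t :: real
  have N: "filterlim N sequentially (at_right 0)"
    unfolding N_def
    by (intro filterlim_compose[OF filterlim_nat_sequentially] filterlim_compose[OF filterlim_floor_sequentially]
        filterlim_inverse_at_top_right)
  have base: "(\<lambda>n. real n * \<phi> (1 / real n)) \<longlonglongrightarrow> L x"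
    unfolding \<phi>_def by (rule lim[OF x])
  have ratio: "(\<lambda>n. real (Suc n) / real n) \<longlonglongrightarrow> 1" "(\<lambda>n. real n / real (Suc n)) \<longlonglongrightarrow> 1"
    by real_asymp+
  have "(\<lambda>n. (real n / real (Suc n)) * (real (Suc n) * \<phi> (1 / real (Suc n)))) \<longlonglongrightarrow> 1 * L x"
    by (intro tendsto_mult ratio LIMSEQ_Suc base)
  from filterlim_compose[OF this N]
  show "((\<lambda>t. (real (N t) / real (Suc (N t))) * (real (Suc (N t)) * \<phi> (1 / real (Suc (N t))))) \<longlongrightarrow> L x) (at_right 0)"
    by simp
  have "(\<lambda>n. (real (Suc n) / real n) * (real n * \<phi> (1 / real n))) \<longlonglongrightarrow> 1 * L x"
    by (intro tendsto_mult ratio base)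
  from filterlim_compose[OF this N]
  show "((\<lambda>t. (real (Suc (N t)) / real (N t)) * (real (N t) * \<phi> (1 / real (N t)))) \<longlongrightarrow> L x) (at_right 0)"
    by simp
  have small: "\<forall>\<^sub>F t in at_right 0. 0 < t \<and> t < (1::real)"
    by (auto simp: eventually_at_right_field intro: exI[of _ 1])
  have bounds: "1 \<le> real (N t)" "real (N t) \<le> 1 / t" "1 / t \<le> real (Suc (N t))" if "0 < t \<and> t < 1" for t
  proof -
    have "1 \<le> inverse t" using that by (simp add: one_le_inverse_iff)
    then have fl: "1 \<le> \<lfloor>inverse t\<rfloor>" by (simp add: le_floor_iff)
    moreover have "real (N t) = of_int \<lfloor>inverse t\<rfloor>"
      unfolding N_def by (rule of_nat_nat) (use fl in linarith)
    ultimately show "1 \<le> real (N t)" "real (N t) \<le> 1 / t" "1 / t \<le> real (Suc (N t))"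
      by (auto simp: inverse_eq_divide) linarith
  qed
  show "\<forall>\<^sub>F t in at_right 0. (real (N t) / real (Suc (N t))) * (real (Suc (N t)) * \<phi> (1 / real (Suc (N t))))
      \<le> (1 - C (1 + t *\<^sub>R x)) / t"
    using small
  proof eventually_elim
    case (elim t)
    note b = bounds[OF elim]
    have "1 / real (Suc (N t)) \<le> t" using b elim by (simp add: field_simps)
    then have "real (N t) * \<phi> (1 / real (Suc (N t))) \<le> (1 / t) * \<phi> t"
      using b nonneg elim by (intro mult_mono mono) auto
    then show ?case by (simp add: \<phi>_def)
  qed
  show "\<forall>\<^sub>F t in at_right 0. (1 - C (1 + t *\<^sub>R x)) / t
      \<le> (real (Suc (N t)) / real (N t)) * (real (N t) * \<phi> (1 / real (N t)))"
    using small
  proof eventually_elim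
    case (elim t)
    note b = bounds[OF elim]
    have "t \<le> 1 / real (N t)" using b elim by (simp add: field_simps)
    then have "(1 / t) * \<phi> t \<le> real (Suc (N t)) * \<phi> (1 / real (N t))"
      using b nonneg elim by (intro mult_mono mono) auto
    then show ?case using b by (simp add: \<phi>_def)
  qed
qed

lemma L_scaleR:
  assumes x: "x \<le> 0" and c: "0 < c"
  shows "L (c *\<^sub>R x) = c * L x"
proof (rule tendsto_unique[OF trivial_limit_at_right_real])
  have "c *\<^sub>R x \<le> 0" using x c by (simp add: less_eq_vec_def mult_nonneg_nonpos)
  from lim_at_right[OF this]
  show "((\<lambda>t. (1 - C (1 + t *\<^sub>R (c *\<^sub>R x))) / t) \<longlongrightarrow> L (c *\<^sub>R x)) (at_right 0)" .
  have "LIM t at_right 0. c * t :> at_right (0::real)"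
    by (rule filterlim_times_pos[of "\<lambda>t. t", OF filterlim_ident c]) simp
  from tendsto_mult[OF tendsto_const[of c] filterlim_compose[OF lim_at_right[OF x] this]]
  have "((\<lambda>t. c * ((1 - C (1 + (c * t) *\<^sub>R x)) / (c * t))) \<longlongrightarrow> c * L x) (at_right 0)" .
  then show "((\<lambda>t. (1 - C (1 + t *\<^sub>R (c *\<^sub>R x))) / t) \<longlongrightarrow> c * L x) (at_right 0)"
    using c by (simp add: mult.commute)
qed

text \<open>\<open>d k\<close> is the defect of subadditivity at level \<open>k\<close>. Times
  \<open>k\<close> it tends to the defect of \<open>L\<close>, yet its partial sums stay below 1, so
  the defect cannot be positive.\<close>

lemma L_subadditive:
  assumes "x \<le> 0" "y \<le> 0"
  shows "L (x + y) \<le> L x + L y"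
proof -
  define d where "d k = (1 - C (1 + (1 / real k) *\<^sub>R (x + y))) - (1 - C (1 + (1 / real k) *\<^sub>R x))
    - (1 - C (1 + (1 / real k) *\<^sub>R y))" for k
  have xy: "x + y \<le> 0" using assms by (simp add: less_eq_vec_def add_nonpos_nonpos)
  have "(\<lambda>k. real k * d k) \<longlonglongrightarrow> L (x + y) - L x - L y"
    using tendsto_diff[OF tendsto_diff[OF lim[OF xy] lim[OF assms(1)]] lim[OF assms(2)]]
    by (simp add: d_def right_diff_distrib)
  then have "L (x + y) - L x - L y \<le> 0"
  proof (rule harmonic_rate_nonpos)
    fix n
    show "(\<Sum>k<n. d k) \<le> 1"
    proof (cases n)
      case (Suc m)
      have "(\<Sum>k<n. d k) = d 0 + (\<Sum>k=1..m. d k)"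
        by (simp add: Suc lessThan_Suc_atMost atMost_atLeast0 sum.atLeast_Suc_atMost)
      \<comment> \<open>Division by zero yields \<open>1 / real 0 = 0\<close>, so all three terms of
        \<open>d 0\<close> are \<open>1 - C 1\<close>.\<close>
      also have "d 0 = 0" by (simp add: d_def C_one)
      also have "(\<Sum>k=1..m. d k) \<le> 1"
        using sum_tail_subadditive[OF df assms, of m] unfolding d_def by (simp add: sum_subtractf)
      finally show ?thesis by simp
    qed simp
  qed
  then show ?thesis by simp
qed

text \<open>\<open>tail_limit\<close> says nothing about \<open>L\<close> off the negative orthant;
  reflecting every coordinate into it extends \<open>L\<close> to a norm. As \<open>L\<close> is
  antimonotone there, the componentwise triangle inequality points the right way.\<close>

definition neg_abs :: "real ^ 'm \<Rightarrow> real ^ 'm" where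
  "neg_abs x = (\<chi> i. - \<bar>x $ i\<bar>)"

lemma neg_abs_le: "neg_abs x \<le> 0"
  by (simp add: neg_abs_def less_eq_vec_def)

lemma neg_abs_eq: "x \<le> 0 \<Longrightarrow> neg_abs x = x"
  by (simp add: neg_abs_def less_eq_vec_def vec_eq_iff)

definition D :: "real ^ 'm \<Rightarrow> real" where
  "D x = L (neg_abs x)"

lemma D_eq_L: "x \<le> 0 \<Longrightarrow> D x = L x"
  by (simp add: D_def neg_abs_eq)

lemma is_norm_D: "is_norm D"
  unfolding is_norm_def
proof (intro conjI allI)
  fix x
  show "D x = 0 \<longleftrightarrow> x = 0"
  proof
    assume "D x = 0"
    then have "\<bar>x $ i\<bar> \<le> 0" for i
      using L_lower[OF neg_abs_le, of x i] by (simp add: D_def neg_abs_def)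
    then show "x = 0" by (simp add: vec_eq_iff)
  next
    assume "x = 0"
    then show "D x = 0" by (simp add: D_eq_L L_zero)
  qed
  fix c :: real
  show "D (c *\<^sub>R x) = \<bar>c\<bar> * D x"
  proof (cases "c = 0")
    case False
    have "neg_abs (c *\<^sub>R x) = \<bar>c\<bar> *\<^sub>R neg_abs x"
      by (simp add: neg_abs_def vec_eq_iff abs_mult)
    then show ?thesis using L_scaleR[OF neg_abs_le, of "\<bar>c\<bar>" x] False by (simp add: D_def)
  qed (simp add: D_eq_L L_zero)
next
  fix x y
  have "L (neg_abs (x + y)) \<le> L (neg_abs x + neg_abs y)"
    by (rule L_antimono[OF _ neg_abs_le]) (simp add: neg_abs_def less_eq_vec_def abs_triangle_ineq algebra_simps)
  also have "\<dots> \<le> L (neg_abs x) + L (neg_abs y)"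
    by (intro L_subadditive neg_abs_le)
  finally show "D (x + y) \<le> D x + D y" by (simp add: D_def)
qed

end

section \<open>Uniform expansions\<close>

lemma is_norm_nonneg:
  assumes "is_norm N"
  shows "0 \<le> N x"
proof -
  have "N (x + (- 1) *\<^sub>R x) \<le> N x + N ((- 1) *\<^sub>R x)" "N ((- 1) *\<^sub>R x) = \<bar>- 1\<bar> * N x" "N 0 = 0"
    using assms unfolding is_norm_def by blast+
  then show ?thesis by simp
qed

lemma is_norm_norm: "is_norm (norm :: 'a::real_normed_vector \<Rightarrow> real)"
  by (simp add: is_norm_def norm_triangle_ineq)

lemma is_norm_le_norm:
  fixes N :: "real ^ 'm \<Rightarrow> real"
  assumes "is_norm N"
  shows "\<exists>A>0. \<forall>x. N x \<le> A * norm x"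
proof -
  have N: "N 0 = 0" "\<And>c x. N (c *\<^sub>R x) = \<bar>c\<bar> * N x" "\<And>x y. N (x + y) \<le> N x + N y"
    using assms unfolding is_norm_def by blast+
  have sum: "N (\<Sum>i\<in>I. f i) \<le> (\<Sum>i\<in>I. N (f i))" if "finite I" for I and f :: "'m \<Rightarrow> real ^ 'm"
    using that
  proof induction
    case (insert i I)
    then show ?case using N(3)[of "f i" "\<Sum>i\<in>I. f i"] by simp
  qed (simp add: N)
  let ?A = "(\<Sum>i\<in>UNIV. N (axis i 1)) + 1"
  have A: "0 \<le> (\<Sum>i\<in>UNIV. N (axis i (1::real)))"
    by (intro sum_nonneg is_norm_nonneg[OF assms])
  have "N x \<le> ?A * norm x" for x
  proof -
    have "N x = N (\<Sum>i\<in>UNIV. x $ i *\<^sub>R axis i 1)"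
      by (metis basis_expansion scalar_mult_eq_scaleR)
    also have "\<dots> \<le> (\<Sum>i\<in>UNIV. N (x $ i *\<^sub>R axis i 1))" by (rule sum) simp
    also have "\<dots> = (\<Sum>i\<in>UNIV. \<bar>x $ i\<bar> * N (axis i 1))" by (simp add: N)
    also have "\<dots> \<le> (\<Sum>i\<in>UNIV. norm x * N (axis i 1))"
      by (intro sum_mono mult_right_mono component_le_norm_cart is_norm_nonneg[OF assms])
    also have "\<dots> \<le> ?A * norm x" by (simp add: sum_distrib_left algebra_simps)
    finally show ?thesis .
  qed
  then show ?thesis using A by (intro exI[of _ ?A]) auto
qed

lemma norm_le_is_norm:
  fixes N :: "real ^ 'm \<Rightarrow> real"
  assumes "is_norm N"
  shows "\<exists>A>0. \<forall>x. norm x \<le> A * N x"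
proof -
  have N: "\<And>x. N x = 0 \<longleftrightarrow> x = 0" "\<And>c x. N (c *\<^sub>R x) = \<bar>c\<bar> * N x" "\<And>x y. N (x + y) \<le> N x + N y"
    using assms unfolding is_norm_def by blast+
  obtain A where A: "A > 0" "\<And>x. N x \<le> A * norm x"
    using is_norm_le_norm[OF assms] by blast
  have diff: "N x - N y \<le> A * norm (x - y)" for x y
    using N(3)[of "x - y" y] A(2)[of "x - y"] by simp
  have "\<bar>N x - N y\<bar> \<le> A * dist x y" for x y
    using diff[of x y] diff[of y x] by (simp add: abs_le_iff dist_norm norm_minus_commute)
  then have "A-lipschitz_on UNIV N"
    using A(1) by (auto intro!: lipschitz_onI simp: dist_real_def)
  then have "continuous_on (sphere 0 1) N"
    using lipschitz_on_continuous_on continuous_on_subset by blast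
  moreover have "sphere (0 :: real ^ 'm) 1 \<noteq> {}" by simp
  ultimately obtain v where v: "v \<in> sphere 0 1" "\<And>u. u \<in> sphere 0 1 \<Longrightarrow> N v \<le> N u"
    using continuous_attains_inf[of "sphere 0 1" N] by auto
  have Nv: "N v > 0"
    using v(1) N(1)[of v] is_norm_nonneg[OF assms, of v] by (cases "v = 0") auto
  have "norm x \<le> (1 / N v) * N x" for x
  proof (cases "x = 0")
    case False
    have "N v \<le> N ((1 / norm x) *\<^sub>R x)" using False by (intro v(2)) simp
    also have "\<dots> = N x / norm x" by (simp add: N(2))
    finally show ?thesis using Nv False by (simp add: field_simps)
  qed (simp add: is_norm_nonneg[OF assms])
  then show ?thesis using Nv by (intro exI[of _ "1 / N v"]) auto
qed

text \<open>By the equivalence of norms, one expansion in the Euclidean norm serves both for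
  \<open>N\<close> and for the norm \<open>D\<close> that it contains.\<close>

lemma unif_small_o_transfer:
  assumes N: "is_norm N" and N': "is_norm N'" and R: "unif_small_o N R"
  shows "unif_small_o N' R"
proof -
  obtain A where A: "A > 0" "\<And>x. N x \<le> A * norm x" using is_norm_le_norm[OF N] by blast
  obtain B where B: "B > 0" "\<And>x. norm x \<le> B * N' x" using norm_le_is_norm[OF N'] by blast
  have AB: "N x \<le> (A * B) * N' x" for x
    using order_trans[OF A(2)[of x] mult_left_mono[OF B(2)[of x], of A]] A(1) by (simp add: mult.assoc)
  have ab: "A * B > 0" using A B by simp
  show ?thesis
    unfolding unif_small_o_def
  proof (intro allI impI)
    fix \<epsilon> :: real assume "\<epsilon> > 0"
    then have "\<epsilon> / (A * B) > 0" using ab by simp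
    then obtain \<delta> where \<delta>: "\<delta> > 0"
      "\<And>y. 0 \<le> y \<and> y \<le> 1 \<and> N (y - 1) \<le> \<delta> \<Longrightarrow> \<bar>R y\<bar> \<le> \<epsilon> / (A * B) * N (y - 1)"
      using R unfolding unif_small_o_def by meson
    show "\<exists>\<delta>>0. \<forall>y. 0 \<le> y \<and> y \<le> 1 \<and> N' (y - 1) \<le> \<delta> \<longrightarrow> \<bar>R y\<bar> \<le> \<epsilon> * N' (y - 1)"
    proof (intro exI[of _ "\<delta> / (A * B)"] conjI allI impI)
      fix y assume y: "0 \<le> y \<and> y \<le> 1 \<and> N' (y - 1) \<le> \<delta> / (A * B)"
      then have "(A * B) * N' (y - 1) \<le> \<delta>" using ab by (simp add: pos_le_divide_eq mult.commute)
      then have "\<bar>R y\<bar> \<le> \<epsilon> / (A * B) * N (y - 1)" using y AB[of "y - 1"] by (intro \<delta>(2)) auto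
      also have "\<dots> \<le> \<epsilon> / (A * B) * ((A * B) * N' (y - 1))"
        using \<open>\<epsilon> / (A * B) > 0\<close> by (intro mult_left_mono AB) auto
      also have "\<dots> = \<epsilon> * N' (y - 1)" using A(1) B(1) by simp
      finally show "\<bar>R y\<bar> \<le> \<epsilon> * N' (y - 1)" .
    qed (use \<delta> ab in simp)
  qed
qed

text \<open>Only the behaviour near 1 counts; \<open>W (y - 1)\<close> is known to equal
  \<open>1 - D (y - 1)\<close> only there.\<close>

lemma unif_small_o_cong:
  assumes R: "unif_small_o N R" and "\<eta> > 0"
    and eq: "\<And>y. 0 \<le> y \<Longrightarrow> y \<le> 1 \<Longrightarrow> N (y - 1) \<le> \<eta> \<Longrightarrow> R' y = R y"
  shows "unif_small_o N R'"
  unfolding unif_small_o_def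
proof (intro allI impI)
  fix \<epsilon> :: real assume "\<epsilon> > 0"
  then obtain \<delta> where \<delta>: "\<delta> > 0"
    "\<And>y. 0 \<le> y \<and> y \<le> 1 \<and> N (y - 1) \<le> \<delta> \<Longrightarrow> \<bar>R y\<bar> \<le> \<epsilon> * N (y - 1)"
    using R unfolding unif_small_o_def by meson
  then show "\<exists>\<delta>>0. \<forall>y. 0 \<le> y \<and> y \<le> 1 \<and> N (y - 1) \<le> \<delta> \<longrightarrow> \<bar>R' y\<bar> \<le> \<epsilon> * N (y - 1)"
    using \<open>\<eta> > 0\<close> eq by (intro exI[of _ "min \<delta> \<eta>"]) auto
qed

section \<open>From expansions to tail limits\<close>

lemma scaled_eventually_ge:
  fixes x x0 :: "real ^ 'm"
  assumes "\<And>i. x0 $ i < 0"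
  shows "\<forall>\<^sub>F n in sequentially. x0 \<le> (1 / real n) *\<^sub>R x"
proof -
  have "\<forall>\<^sub>F n in sequentially. x0 $ i \<le> x $ i / real n" for i
    using order_tendstoD(1)[OF lim_const_over_n[of "x $ i"] assms[of i]]
    by (rule eventually_mono) simp
  then have "\<forall>\<^sub>F n in sequentially. \<forall>i. x0 $ i \<le> x $ i / real n"
    by (rule eventually_all_finite)
  then show ?thesis by (simp add: less_eq_vec_def)
qed

lemma unif_small_o_ray:
  fixes R :: "real ^ 'm \<Rightarrow> real"
  assumes N: "is_norm N" and R: "unif_small_o N R" and x: "x \<le> 0"
  shows "(\<lambda>n. real n * R (1 + (1 / real n) *\<^sub>R x)) \<longlonglongrightarrow> 0"
proof (rule LIMSEQ_I)
  fix e :: real assume e: "e > 0"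
  have Nx: "0 \<le> N x" by (rule is_norm_nonneg[OF N])
  have scale: "N ((1 / real n) *\<^sub>R x) = N x / real n" for n
    using N unfolding is_norm_def by simp
  \<comment> \<open>The added 1 guards against \<open>N x = 0\<close> and makes the final inequality
    strict.\<close>
  define \<epsilon> where "\<epsilon> = e / (N x + 1)"
  have \<epsilon>: "\<epsilon> > 0" using e Nx by (simp add: \<epsilon>_def)
  then obtain \<delta> where \<delta>: "\<delta> > 0"
    "\<And>y. 0 \<le> y \<and> y \<le> 1 \<and> N (y - 1) \<le> \<delta> \<Longrightarrow> \<bar>R y\<bar> \<le> \<epsilon> * N (y - 1)"
    using R unfolding unif_small_o_def by meson
  have "\<forall>\<^sub>F n in sequentially. N x / real n < \<delta>"
    by (rule order_tendstoD(2)[OF lim_const_over_n \<delta>(1)])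
  moreover have "\<forall>\<^sub>F n in sequentially. (- 1 :: real ^ 'm) \<le> (1 / real n) *\<^sub>R x"
    by (rule scaled_eventually_ge) simp
  ultimately have "\<forall>\<^sub>F n in sequentially. norm (real n * R (1 + (1 / real n) *\<^sub>R x) - 0) < e"
    using eventually_gt_at_top[of 0]
  proof eventually_elim
    case (elim n)
    have "0 \<le> 1 + (1 / real n) *\<^sub>R x"
      unfolding less_eq_vec_def
    proof
      fix i
      have "- 1 \<le> x $ i / real n" using elim(2) by (simp add: less_eq_vec_def)
      then show "0 $ i \<le> (1 + (1 / real n) *\<^sub>R x) $ i" by simp
    qed
    moreover have "1 + (1 / real n) *\<^sub>R x \<le> 1"
      using x by (simp add: less_eq_vec_def divide_nonpos_nonneg)
    ultimately have "\<bar>R (1 + (1 / real n) *\<^sub>R x)\<bar> \<le> \<epsilon> * (N x / real n)"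
      using \<delta>(2)[of "1 + (1 / real n) *\<^sub>R x"] elim(1) by (simp add: scale)
    then have "real n * \<bar>R (1 + (1 / real n) *\<^sub>R x)\<bar> \<le> real n * (\<epsilon> * (N x / real n))"
      by (rule mult_left_mono) simp
    also have "\<dots> = \<epsilon> * N x" using elim by simp
    also have "\<dots> < e" using e Nx by (simp add: \<epsilon>_def field_simps)
    finally show ?case by (simp add: abs_mult)
  qed
  then show "\<exists>no. \<forall>n\<ge>no. norm (real n * R (1 + (1 / real n) *\<^sub>R x) - 0) < e"
    by (simp add: eventually_sequentially)
qed

lemma norm_expansion_tail_limit:
  fixes C :: "real ^ 'm \<Rightarrow> real"
  assumes D: "is_norm D" and "norm_expansion C D"
  shows "tail_limit C D"
  unfolding tail_limit_def
proof (intro allI impI)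
  fix x :: "real ^ 'm" assume x: "x \<le> 0"
  have scale: "D ((1 / real n) *\<^sub>R x) = D x / real n" for n
    using D unfolding is_norm_def by simp
  have "(\<lambda>n. D x - real n * (C (1 + (1 / real n) *\<^sub>R x) - (1 - D (1 + (1 / real n) *\<^sub>R x - 1)))) \<longlonglongrightarrow> D x - 0"
    using assms(2) unfolding norm_expansion_def by (intro tendsto_diff tendsto_const unif_small_o_ray[OF D] x)
  moreover have "\<forall>\<^sub>F n in sequentially. D x - real n * (C (1 + (1 / real n) *\<^sub>R x) - (1 - D (1 + (1 / real n) *\<^sub>R x - 1)))
      = real n * (1 - C (1 + (1 / real n) *\<^sub>R x))"
    using eventually_gt_at_top[of 0] by eventually_elim (simp add: scale field_simps)
  ultimately have "(\<lambda>n. real n * (1 - C (1 + (1 / real n) *\<^sub>R x))) \<longlonglongrightarrow> D x - 0"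
    by (rule Lim_transform_eventually)
  then show "(\<lambda>n. real n * (1 - C (1 + (1 / real n) *\<^sub>R x))) \<longlonglongrightarrow> D x" by simp
qed

text \<open>For large \<open>n\<close> the point \<open>x / n\<close> lies in the box where
  \<open>W = 1 + ln G\<close>, and \<open>evd_power\<close> turns \<open>n * ln (G (x / n))\<close>
  into \<open>ln (G x)\<close>.\<close>

lemma gpd_expansion_tail_limit:
  fixes C :: "real ^ 'm \<Rightarrow> real"
  assumes N: "is_norm N" and "gpd_expansion N C W"
    and G: "evd G" "std_neg_exp_margins G"
    and x0: "\<And>i. x0 $ i < 0" and W: "\<And>x. x0 \<le> x \<Longrightarrow> x \<le> 0 \<Longrightarrow> W x = 1 + ln (G x)"
  shows "tail_limit C (\<lambda>x. - ln (G x))"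
  unfolding tail_limit_def
proof (intro allI impI)
  fix x :: "real ^ 'm" assume x: "x \<le> 0"
  let ?R = "\<lambda>n. C (1 + (1 / real n) *\<^sub>R x) - W (1 + (1 / real n) *\<^sub>R x - 1)"
  have "(\<lambda>n. - ln (G x) - real n * ?R n) \<longlonglongrightarrow> - ln (G x) - 0"
    using assms(2) unfolding gpd_expansion_def by (intro tendsto_diff tendsto_const unif_small_o_ray[OF N] x)
  moreover have "\<forall>\<^sub>F n in sequentially. - ln (G x) - real n * ?R n = real n * (1 - C (1 + (1 / real n) *\<^sub>R x))"
    using eventually_gt_at_top[of 0] scaled_eventually_ge[OF x0, of x]
  proof eventually_elim
    case (elim n)
    have xn: "(1 / real n) *\<^sub>R x \<le> 0" using x by (simp add: less_eq_vec_def divide_nonpos_nonneg)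
    have "G x = G ((1 / real n) *\<^sub>R x) ^ n" using evd_power[OF G, of n x] elim by simp
    then have "ln (G x) = real n * ln (G ((1 / real n) *\<^sub>R x))"
      using evd_pos[OF G xn] by (simp add: ln_realpow)
    then show ?case using W[OF elim(2) xn] by (simp add: algebra_simps)
  qed
  ultimately have "(\<lambda>n. real n * (1 - C (1 + (1 / real n) *\<^sub>R x))) \<longlonglongrightarrow> - ln (G x) - 0"
    by (rule Lim_transform_eventually)
  then show "(\<lambda>n. real n * (1 - C (1 + (1 / real n) *\<^sub>R x))) \<longlonglongrightarrow> - ln (G x)" by simp
qed

context copula_tail
begin

lemma expansion_D: "unif_small_o norm (\<lambda>y. C y - (1 - D (y - 1)))"
  unfolding unif_small_o_def
proof (intro allI impI)
  fix \<epsilon> :: real assume \<epsilon>: "\<epsilon> > 0"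
  define m where "m = real CARD('m)"
  have m: "m > 0" by (simp add: m_def)
  have l1: "(\<Sum>j\<in>UNIV. \<bar>u $ j - v $ j\<bar>) \<le> m * dist u v" for u v :: "real ^ 'm"
  proof -
    have "(\<Sum>j\<in>UNIV. \<bar>u $ j - v $ j\<bar>) \<le> (\<Sum>j\<in>(UNIV :: 'm set). norm (u - v))"
      by (intro sum_mono) (metis component_le_norm_cart vector_minus_component)
    then show ?thesis by (simp add: m_def dist_norm)
  qed
  \<comment> \<open>A net of this width makes the sum distance to the net at most
    \<open>\<epsilon> / 3\<close>. The Lipschitz bounds for \<open>C\<close> and for
    \<open>L\<close> use one third of the error each, the convergence at the finitely many net
    points the last one.\<close>
  define \<rho> where "\<rho> = \<epsilon> / (3 * m)"
  have \<rho>: "\<rho> > 0" "m * \<rho> = \<epsilon> / 3" using \<epsilon> m by (simp_all add: \<rho>_def)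
  define S where "S = sphere 0 1 \<inter> {u :: real ^ 'm. u \<le> 0}"
  have "closed {u :: real ^ 'm. u \<le> 0}"
    unfolding less_eq_vec_def by (intro closed_Collect_all closed_Collect_le continuous_intros)
  then have "compact S" unfolding S_def by (intro compact_Int_closed compact_sphere)
  moreover have "S \<subseteq> (\<Union>v\<in>S. ball v \<rho>)" using \<rho> by auto
  ultimately obtain T where T: "T \<subseteq> S" "finite T" "S \<subseteq> (\<Union>v\<in>T. ball v \<rho>)"
    using compactE_image[of S S "\<lambda>v. ball v \<rho>"] by auto
  have "\<forall>\<^sub>F t in at_right 0. \<bar>(1 - C (1 + t *\<^sub>R v)) / t - L v\<bar> < \<epsilon> / 3" if "v \<in> T" for v
    using tendstoD[OF lim_at_right[of v], of "\<epsilon> / 3"] that T(1) \<epsilon> by (auto simp: S_def dist_real_def)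
  then have "\<forall>\<^sub>F t in at_right 0. \<forall>v\<in>T. \<bar>(1 - C (1 + t *\<^sub>R v)) / t - L v\<bar> < \<epsilon> / 3"
    using T(2) by (simp add: eventually_ball_finite)
  then obtain \<delta> where \<delta>: "\<delta> > 0"
    "\<And>t v. 0 < t \<Longrightarrow> t < \<delta> \<Longrightarrow> v \<in> T \<Longrightarrow> \<bar>(1 - C (1 + t *\<^sub>R v)) / t - L v\<bar> < \<epsilon> / 3"
    unfolding eventually_at_right_field by meson
  show "\<exists>\<delta>>0. \<forall>y. 0 \<le> y \<and> y \<le> 1 \<and> norm (y - 1) \<le> \<delta> \<longrightarrow> \<bar>C y - (1 - D (y - 1))\<bar> \<le> \<epsilon> * norm (y - 1)"
  proof (intro exI[of _ "\<delta> / 2"] conjI allI impI)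
    fix y :: "real ^ 'm" assume y: "0 \<le> y \<and> y \<le> 1 \<and> norm (y - 1) \<le> \<delta> / 2"
    define t where "t = norm (y - 1)"
    show "\<bar>C y - (1 - D (y - 1))\<bar> \<le> \<epsilon> * norm (y - 1)"
    proof (cases "y = 1")
      case True
      then show ?thesis by (simp add: C_one D_eq_L L_zero)
    next
      case False
      then have t: "0 < t" "t < \<delta>" using y \<delta>(1) by (auto simp: t_def)
      define u where "u = (1 / t) *\<^sub>R (y - 1)"
      have tu: "t *\<^sub>R u = y - 1" using t by (simp add: u_def)
      have "norm u = 1" using t by (simp add: u_def t_def)
      moreover have u: "u \<le> 0"
        using y t by (auto simp: u_def less_eq_vec_def divide_le_0_iff)
      ultimately obtain v where v: "v \<in> T" "dist v u < \<rho>"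
        using T(3) by (auto simp: S_def)
      have v0: "v \<le> 0" using v(1) T(1) by (auto simp: S_def)
      have uv: "(\<Sum>j\<in>UNIV. \<bar>v $ j - u $ j\<bar>) \<le> \<epsilon> / 3"
        using l1[of v u] mult_left_mono[of "dist v u" \<rho> m] v(2) m \<rho>(2) by simp
      have "\<bar>C (1 + t *\<^sub>R v) - C (1 + t *\<^sub>R u)\<bar> \<le> (\<Sum>j\<in>UNIV. \<bar>(1 + t *\<^sub>R v) $ j - (1 + t *\<^sub>R u) $ j\<bar>)"
        by (rule copula_lipschitz[OF copula])
      also have "\<dots> = t * (\<Sum>j\<in>UNIV. \<bar>v $ j - u $ j\<bar>)"
        using t by (simp add: sum_distrib_left abs_mult flip: right_diff_distrib)
      also have "\<dots> \<le> t * (\<epsilon> / 3)" using uv t by (intro mult_left_mono) auto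
      finally have 1: "\<bar>C (1 + t *\<^sub>R v) - C (1 + t *\<^sub>R u)\<bar> \<le> t * (\<epsilon> / 3)" .
      have "t * \<bar>L v - L u\<bar> \<le> t * (\<epsilon> / 3)"
        using L_lipschitz[OF v0 u] uv t by (intro mult_left_mono) auto
      then have 2: "\<bar>t * L v - t * L u\<bar> \<le> t * (\<epsilon> / 3)"
        using t by (simp add: abs_mult flip: right_diff_distrib)
      have "t * \<bar>(1 - C (1 + t *\<^sub>R v)) / t - L v\<bar> \<le> t * (\<epsilon> / 3)"
        using \<delta>(2)[OF t v(1)] t by (intro mult_left_mono) auto
      moreover have "t * \<bar>(1 - C (1 + t *\<^sub>R v)) / t - L v\<bar> = \<bar>t * ((1 - C (1 + t *\<^sub>R v)) / t - L v)\<bar>"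
        using t by (simp add: abs_mult)
      moreover have "t * ((1 - C (1 + t *\<^sub>R v)) / t - L v) = 1 - C (1 + t *\<^sub>R v) - t * L v"
        using t by (simp add: field_simps)
      ultimately have 3: "\<bar>1 - C (1 + t *\<^sub>R v) - t * L v\<bar> \<le> t * (\<epsilon> / 3)" by simp
      have "y - 1 \<le> 0" using y by (simp add: less_eq_vec_def)
      then have Dy: "D (y - 1) = t * L u"
        using L_scaleR[OF u t(1)] by (simp add: D_eq_L tu)
      have y_eq: "1 + t *\<^sub>R u = y" by (simp add: tu)
      have "\<bar>C y - (1 - D (y - 1))\<bar> \<le> t * (\<epsilon> / 3) + t * (\<epsilon> / 3) + t * (\<epsilon> / 3)"
        using 1 2 3 unfolding Dy y_eq by linarith
      also have "\<dots> = \<epsilon> * t" by simp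
      finally show ?thesis by (simp add: t_def)
    qed
  qed (use \<delta> in simp)
qed

subsection \<open>The limiting distributions\<close>

text \<open>A copula puts no mass above 1, so the rescaled laws see only the negative parts. Whereas
  \<open>neg_abs\<close> extends \<open>L\<close> to a norm, this extension leads to distribution
  functions.\<close>

definition neg_part :: "real ^ 'm \<Rightarrow> real ^ 'm" where
  "neg_part x = (\<chi> i. min (x $ i) 0)"

lemma neg_part_le: "neg_part x \<le> 0"
  by (simp add: neg_part_def less_eq_vec_def)

lemma neg_part_eq: "x \<le> 0 \<Longrightarrow> neg_part x = x"
  by (simp add: neg_part_def less_eq_vec_def vec_eq_iff min_def)

lemma neg_part_nonneg: "0 \<le> x \<Longrightarrow> neg_part x = 0"
  by (simp add: neg_part_def less_eq_vec_def vec_eq_iff min_absorb2)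

lemma lim_neg_part: "(\<lambda>n. real n * (1 - C (1 + (1 / real n) *\<^sub>R x))) \<longlonglongrightarrow> L (neg_part x)"
proof -
  have "C (1 + (1 / real n) *\<^sub>R x) = C (1 + (1 / real n) *\<^sub>R neg_part x)" for n
  proof -
    have "margin j C ((1 + (1 / real n) *\<^sub>R x) $ j) = margin j C ((1 + (1 / real n) *\<^sub>R neg_part x) $ j)" for j
      unfolding margin_copula[OF copula] by (cases "0 \<le> x $ j") (simp_all add: neg_part_def)
    then show ?thesis
      using distribution_function_lipschitz[OF df, of "1 + (1 / real n) *\<^sub>R x" "1 + (1 / real n) *\<^sub>R neg_part x"] by simp
  qed
  then show ?thesis using lim[OF neg_part_le, of x] by simp
qed

lemma L_neg_part_right: "((\<lambda>h. L (neg_part (x + h *\<^sub>R 1))) \<longlongrightarrow> L (neg_part x)) (at_right 0)"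
proof (rule LIM_zero_cancel, rule Lim_null_comparison)
  show "\<forall>\<^sub>F h in at_right 0. norm (L (neg_part (x + h *\<^sub>R 1)) - L (neg_part x)) \<le> real CARD('m) * h"
    using eventually_at_right_less[of "0::real"]
  proof eventually_elim
    case (elim h)
    have "\<bar>L (neg_part (x + h *\<^sub>R 1)) - L (neg_part x)\<bar>
        \<le> (\<Sum>j\<in>UNIV. \<bar>neg_part (x + h *\<^sub>R 1) $ j - neg_part x $ j\<bar>)"
      by (intro L_lipschitz neg_part_le)
    also have "\<dots> \<le> (\<Sum>j\<in>(UNIV :: 'm set). h)"
      using elim by (intro sum_mono) (simp add: neg_part_def min_def abs_le_iff)
    finally show ?case by simp
  qed
  have "((\<lambda>h. real CARD('m) * h) \<longlongrightarrow> real CARD('m) * 0) (at_right 0)"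
    by (intro tendsto_intros)
  then show "((\<lambda>h. real CARD('m) * h) \<longlongrightarrow> 0) (at_right 0)" by simp
qed

lemma rescaled_copula_df: "distribution_function (\<lambda>x. C (1 + (1 / real (Suc n)) *\<^sub>R x))"
proof -
  have "((1 / real (Suc n)) *\<^sub>R 1) * x + 1 = 1 + (1 / real (Suc n)) *\<^sub>R x" for x :: "real ^ 'm"
    by (simp add: vec_eq_iff)
  then show ?thesis
    using distribution_function_affine[OF df, of "(1 / real (Suc n)) *\<^sub>R 1" 1] by (simp add: add.commute)
qed

definition G :: "real ^ 'm \<Rightarrow> real" where
  "G x = exp (- L (neg_part x))"

lemma G_eq: "x \<le> 0 \<Longrightarrow> G x = exp (- L x)"
  by (simp add: G_def neg_part_eq)

text \<open>\<open>G\<close> is the limit of the laws of normalized componentwise maxima of samples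
  from \<open>C\<close>; the index \<open>Suc n\<close> keeps scale and sample size
  positive.\<close>

lemma distribution_function_G: "distribution_function G"
proof (rule distribution_function_limit)
  show "distribution_function (\<lambda>x. C (1 + (1 / real (Suc n)) *\<^sub>R x) ^ Suc n)" for n
    by (rule distribution_function_power[OF rescaled_copula_df]) simp
  show "(\<lambda>n. C (1 + (1 / real (Suc n)) *\<^sub>R x) ^ Suc n) \<longlonglongrightarrow> G x" for x
    using LIMSEQ_Suc[OF LIMSEQ_power_exp[OF lim_neg_part[of x]]] unfolding G_def .
  show "((\<lambda>h. G (x + h *\<^sub>R 1)) \<longlongrightarrow> G x) (at_right 0)" for x
    unfolding G_def by (intro tendsto_intros L_neg_part_right)
  have "G (s *\<^sub>R 1) = 1" if "s \<ge> 0" for s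
    using that by (simp add: G_def neg_part_nonneg L_zero less_eq_vec_def)
  then show "((\<lambda>s. G (s *\<^sub>R 1)) \<longlongrightarrow> 1) at_top"
    by (intro tendsto_eventually eventually_at_top_linorderI[of 0]) auto
  show "((\<lambda>t. G (\<chi> j. if j = i then t else s)) \<longlongrightarrow> 0) at_bot" for i s
  proof (rule tendsto_sandwich)
    show "\<forall>\<^sub>F t in at_bot. 0 \<le> G (\<chi> j. if j = i then t else s)" by (simp add: G_def)
    show "\<forall>\<^sub>F t in at_bot. G (\<chi> j. if j = i then t else s) \<le> exp t"
      using eventually_le_at_bot[of "0::real"]
    proof eventually_elim
      case (elim t)
      then show ?case
        using L_lower[OF neg_part_le, of "\<chi> j. if j = i then t else s" i] by (simp add: G_def neg_part_def)
    qed
    show "(exp \<longlongrightarrow> (0::real)) at_bot" by (rule exp_at_bot)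
  qed simp
qed

lemma margin_G:
  assumes "t \<le> 0"
  shows "margin i G t = exp t"
proof (rule margin_eventually_const[of 0])
  fix s :: real assume "0 \<le> s"
  then have "neg_part (\<chi> j. if j = i then t else s) = coord i t"
    using assms by (simp add: neg_part_def vec_eq_iff coord_nth)
  then show "G (\<chi> j. if j = i then t else s) = exp t"
    using assms by (simp add: G_def L_coord)
qed

lemma std_G: "std_neg_exp_margins G"
  by (simp add: std_neg_exp_margins_def margin_G)

lemma evd_G: "evd G"
  unfolding evd_def
proof (intro conjI allI)
  fix i
  \<comment> \<open>A degenerate margin takes only the values 0 and 1, and its value at
    \<open>-1\<close> would be \<open>exp (- 1)\<close>.\<close>
  have "exp (- 1) \<noteq> (1 :: real)" by simp
  then show "\<not> degenerate (margin i G)"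
    unfolding degenerate_def using margin_G[of "-1" i] by (metis exp_not_eq_zero neg_le_0_iff_le zero_le_one)
next
  show "max_stable G"
    unfolding max_stable_def
  proof (intro allI impI exI conjI)
    fix n :: nat and i :: 'm and x :: "real ^ 'm" assume n: "1 \<le> n"
    show "0 < ((1 / real n) *\<^sub>R 1 :: real ^ 'm) $ i" using n by simp
    have "((1 / real n) *\<^sub>R 1) * x + 0 = (1 / real n) *\<^sub>R x"
      by (simp add: vec_eq_iff)
    moreover have "neg_part ((1 / real n) *\<^sub>R x) = (1 / real n) *\<^sub>R neg_part x"
      using n by (auto simp: neg_part_def vec_eq_iff min_def divide_le_0_iff zero_le_divide_iff)
    moreover have "L ((1 / real n) *\<^sub>R neg_part x) = (1 / real n) * L (neg_part x)"
      using n by (intro L_scaleR neg_part_le) simp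
    ultimately have "G (((1 / real n) *\<^sub>R 1) * x + 0) = exp (- (L (neg_part x) / real n))"
      by (simp add: G_def)
    then show "G (((1 / real n) *\<^sub>R 1) * x + 0) ^ n = G x"
      using n by (simp add: G_def flip: exp_of_nat_mult)
  qed
qed (rule distribution_function_G)

lemma domain_of_attraction_G: "in_domain_of_attraction C G"
  unfolding in_domain_of_attraction_def
proof (intro exI conjI allI)
  \<comment> \<open>\<open>max 1 n\<close> keeps the scale positive at \<open>n = 0\<close>, since
    positivity is demanded for every \<open>n\<close>.\<close>
  let ?a = "\<lambda>n::nat. (1 / real (max 1 n)) *\<^sub>R 1 :: real ^ 'm"
  show "0 < ?a n $ i" for n i by simp
  fix x
  have "\<forall>\<^sub>F n in sequentially. C (1 + (1 / real n) *\<^sub>R x) ^ n = C (?a n * x + 1) ^ n"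
    using eventually_ge_at_top[of 1]
  proof eventually_elim
    case (elim n)
    then have "?a n * x + 1 = 1 + (1 / real n) *\<^sub>R x" by (simp add: vec_eq_iff max_absorb2)
    then show ?case by (simp only:)
  qed
  with LIMSEQ_power_exp[OF lim_neg_part[of x]] show "(\<lambda>n. C (?a n * x + 1) ^ n) \<longlonglongrightarrow> G x"
    unfolding G_def by (rule Lim_transform_eventually)
qed

text \<open>\<open>W\<close> is the limit law of \<open>n (U - 1)\<close> cut off from below at \<open>- \<delta>\<close>, given that some component
  exceeds \<open>- \<delta>\<close>; this \<open>\<delta>\<close> makes the normalizing constant 1.\<close>

definition \<delta> :: real where
  "\<delta> = 1 / L (- 1)"

lemma \<delta>_pos: "0 < \<delta>"
proof -
  have "1 \<le> L (- 1)" using L_lower[of "- 1"] by (simp add: less_eq_vec_def)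
  then show ?thesis by (simp add: \<delta>_def)
qed

definition W :: "real ^ 'm \<Rightarrow> real" where
  "W x = (if - (\<delta> *\<^sub>R 1) \<le> x then 1 - L (neg_part x) else 0)"

lemma L_\<delta>: "L (- (\<delta> *\<^sub>R 1)) = 1"
proof -
  have "L (\<delta> *\<^sub>R (- 1)) = \<delta> * L (- 1)"
    by (rule L_scaleR[OF _ \<delta>_pos]) (simp add: less_eq_vec_def)
  moreover have "L (- 1) \<noteq> 0" using \<delta>_pos by (auto simp: \<delta>_def)
  ultimately show ?thesis by (simp add: \<delta>_def)
qed

lemma distribution_function_W: "distribution_function W"
proof (rule distribution_function_limit)
  let ?a = "- (\<delta> *\<^sub>R 1) :: real ^ 'm"
  let ?F = "\<lambda>n x. C (1 + (1 / real (Suc n)) *\<^sub>R x)"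
  have a0: "?a \<le> 0" using \<delta>_pos by (simp add: less_eq_vec_def)
  have "?F n ?a < 1" for n
  proof -
    have "?F n ?a \<le> max 0 (min 1 (1 - \<delta> / real (Suc n)))"
      using distribution_function_le_margin[OF df, of "1 + (1 / real (Suc n)) *\<^sub>R ?a"]
      by (simp add: margin_copula[OF copula])
    also have "\<dots> < 1" using \<delta>_pos by simp
    finally show ?thesis .
  qed
  then show "distribution_function (\<lambda>x. if ?a \<le> x then (?F n x - ?F n ?a) / (1 - ?F n ?a) else 0)" for n
    by (intro distribution_function_conditioned rescaled_copula_df)
  show "(\<lambda>n. if ?a \<le> x then (?F n x - ?F n ?a) / (1 - ?F n ?a) else 0) \<longlonglongrightarrow> W x" for x
  proof (cases "?a \<le> x")
    case True
    \<comment> \<open>The conditional probability is one minus a quotient of tails; the factor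
      \<open>Suc n\<close> makes both tails converge, and the denominator tends to 1 by
      \<open>L_\<delta>\<close>.\<close>
    have "(\<lambda>n. 1 - (real (Suc n) * (1 - ?F n x)) / (real (Suc n) * (1 - ?F n ?a)))
        \<longlonglongrightarrow> 1 - L (neg_part x) / L (neg_part ?a)"
      using LIMSEQ_Suc[OF lim_neg_part[of x]] LIMSEQ_Suc[OF lim_neg_part[of ?a]]
      by (intro tendsto_diff tendsto_const tendsto_divide) (auto simp: neg_part_eq[OF a0] L_\<delta>)
    moreover have "1 - (real (Suc n) * (1 - ?F n x)) / (real (Suc n) * (1 - ?F n ?a))
        = (?F n x - ?F n ?a) / (1 - ?F n ?a)" for n
      using \<open>?F n ?a < 1\<close> by (simp add: divide_simps del: of_nat_Suc)
    ultimately show ?thesis using True by (simp add: W_def neg_part_eq[OF a0] L_\<delta>)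
  qed (simp add: W_def)
  show "((\<lambda>h. W (x + h *\<^sub>R 1)) \<longlongrightarrow> W x) (at_right 0)" for x
  proof (cases "?a \<le> x")
    case True
    have "\<forall>\<^sub>F h in at_right 0. 1 - L (neg_part (x + h *\<^sub>R 1)) = W (x + h *\<^sub>R 1)"
      using eventually_at_right_less[of "0::real"]
    proof eventually_elim
      case (elim h)
      then have "?a \<le> x + h *\<^sub>R 1" using True by (simp add: less_eq_vec_def add_increasing2)
      then show ?case by (simp add: W_def)
    qed
    moreover have "((\<lambda>h. 1 - L (neg_part (x + h *\<^sub>R 1))) \<longlongrightarrow> 1 - L (neg_part x)) (at_right 0)"
      by (intro tendsto_diff tendsto_const L_neg_part_right)
    ultimately show ?thesis
      using True Lim_transform_eventually[of "\<lambda>h. 1 - L (neg_part (x + h *\<^sub>R 1))"] by (simp add: W_def)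
  next
    case False
    then obtain i where i: "x $ i < - \<delta>" by (auto simp: less_eq_vec_def not_le)
    then have "\<forall>\<^sub>F h in at_right 0. h < - \<delta> - x $ i"
      by (intro order_tendstoD(2)[OF tendsto_ident_at]) simp
    then have "\<forall>\<^sub>F h in at_right 0. W (x + h *\<^sub>R 1) = 0"
    proof eventually_elim
      case (elim h)
      then have "\<not> ?a \<le> x + h *\<^sub>R 1" by (auto simp: less_eq_vec_def not_le intro!: exI[of _ i])
      then show ?case by (simp add: W_def)
    qed
    then show ?thesis using False by (simp add: W_def tendsto_eventually)
  qed
  have "W (s *\<^sub>R 1) = 1" if "s \<ge> 0" for s
  proof -
    have "?a \<le> s *\<^sub>R 1" using that \<delta>_pos by (simp add: less_eq_vec_def)
    then show ?thesis using that by (simp add: W_def neg_part_nonneg L_zero less_eq_vec_def)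
  qed
  then show "((\<lambda>s. W (s *\<^sub>R 1)) \<longlongrightarrow> 1) at_top"
    by (intro tendsto_eventually eventually_at_top_linorderI[of 0]) auto
  show "((\<lambda>t. W (\<chi> j. if j = i then t else s)) \<longlongrightarrow> 0) at_bot" for i s
  proof (rule tendsto_eventually)
    show "\<forall>\<^sub>F t in at_bot. W (\<chi> j. if j = i then t else s) = 0"
      using eventually_gt_at_bot[of "- \<delta>"]
    proof eventually_elim
      case (elim t)
      then have "\<not> ?a \<le> (\<chi> j. if j = i then t else s)"
        by (auto simp: less_eq_vec_def not_le intro!: exI[of _ i])
      then show ?case by (simp add: W_def)
    qed
  qed
qed

lemma W_eq: "- (\<delta> *\<^sub>R 1) \<le> x \<Longrightarrow> x \<le> 0 \<Longrightarrow> W x = 1 - D x"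
  by (simp add: W_def D_eq_L neg_part_eq)

lemma gpd_W: "gpd_uniform W"
  unfolding gpd_uniform_def
proof (intro conjI exI allI impI)
  show "(- (\<delta> *\<^sub>R 1) :: real ^ 'm) $ i < 0" for i using \<delta>_pos by simp
  show "W x = 1 + ln (G x)" if "- (\<delta> *\<^sub>R 1) \<le> x \<and> x \<le> 0" for x
    using that by (simp add: W_eq G_eq D_eq_L)
qed (rule distribution_function_W evd_G std_G)+

lemma norm_expansion_D: "norm_expansion C D"
  unfolding norm_expansion_def by (rule unif_small_o_transfer[OF is_norm_norm is_norm_D expansion_D])

lemma gpd_expansion_W:
  assumes "is_norm N"
  shows "gpd_expansion N C W"
proof -
  have "unif_small_o norm (\<lambda>y. C y - W (y - 1))"
  proof (rule unif_small_o_cong[OF expansion_D \<delta>_pos])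
    fix y :: "real ^ 'm" assume y: "0 \<le> y" "y \<le> 1" "norm (y - 1) \<le> \<delta>"
    \<comment> \<open>Within Euclidean distance \<open>\<delta>\<close> of 1, \<open>y - 1\<close>
      stays in the box on which \<open>W\<close> is \<open>1 - D\<close>.\<close>
    have "- \<delta> \<le> (y - 1) $ i" for i
      using component_le_norm_cart[of "y - 1" i] y(3) by linarith
    then have "- (\<delta> *\<^sub>R 1) \<le> y - 1" by (simp add: less_eq_vec_def)
    moreover have "y - 1 \<le> 0" using y by (simp add: less_eq_vec_def)
    ultimately show "C y - W (y - 1) = C y - (1 - D (y - 1))" by (simp add: W_eq)
  qed
  then show ?thesis
    unfolding gpd_expansion_def by (rule unif_small_o_transfer[OF is_norm_norm assms])
qed

end

theorem corollary2p2:
  fixes C N :: "real ^ 'm \<Rightarrow> real"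
  assumes "copula C" and "is_norm N"
  shows "((\<exists>G. evd G \<and> std_neg_exp_margins G \<and> in_domain_of_attraction C G) \<longleftrightarrow>
          (\<exists>W. gpd_uniform W \<and> gpd_expansion N C W)) \<and>
         ((\<exists>W. gpd_uniform W \<and> gpd_expansion N C W) \<longleftrightarrow>
          (\<exists>D. is_norm D \<and> norm_expansion C D)) \<and>
         (\<forall>G. evd G \<and> std_neg_exp_margins G \<and> in_domain_of_attraction C G \<longrightarrow>
            (\<forall>W. gpd_uniform W \<and> gpd_expansion N C W \<longrightarrow>
               (\<exists>x0. (\<forall>i. x0 $ i < 0) \<and>
                  (\<forall>x. x0 \<le> x \<and> x \<le> 0 \<longrightarrow> W x = 1 + ln (G x)))) \<and>
            (\<forall>D. is_norm D \<and> norm_expansion C D \<longrightarrow>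
               (\<forall>x. x \<le> 0 \<longrightarrow> G x = exp (- D x))))"
proof -
  have from_G: "tail_limit C (\<lambda>x. - ln (G x))"
    if "evd G \<and> std_neg_exp_margins G \<and> in_domain_of_attraction C G" for G
    using that domain_of_attraction_tail_limit[OF assms(1)] by blast
  have from_W: "\<exists>G x0. evd G \<and> std_neg_exp_margins G \<and> (\<forall>i. x0 $ i < 0) \<and>
      (\<forall>x. x0 \<le> x \<and> x \<le> 0 \<longrightarrow> W x = 1 + ln (G x)) \<and> tail_limit C (\<lambda>x. - ln (G x))"
    if W: "gpd_uniform W \<and> gpd_expansion N C W" for W
  proof -
    obtain G x0 where G: "evd G" "std_neg_exp_margins G" "\<forall>i. x0 $ i < 0"
        "\<forall>x. x0 \<le> x \<and> x \<le> 0 \<longrightarrow> W x = 1 + ln (G x)"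
      using W unfolding gpd_uniform_def by blast
    then have "tail_limit C (\<lambda>x. - ln (G x))"
      using W by (intro gpd_expansion_tail_limit[OF assms(2), of _ W _ x0]) auto
    with G show ?thesis by blast
  qed
  have from_D: "tail_limit C D" if "is_norm D \<and> norm_expansion C D" for D
    using that norm_expansion_tail_limit by blast
  \<comment> \<open>Each condition yields some tail limit, and any tail limit yields all three
    conditions; this closes every implication at once.\<close>
  have all: "(\<exists>G. evd G \<and> std_neg_exp_margins G \<and> in_domain_of_attraction C G) \<and>
      (\<exists>W. gpd_uniform W \<and> gpd_expansion N C W) \<and> (\<exists>D. is_norm D \<and> norm_expansion C D)"
    if "tail_limit C L" for L
  proof -
    interpret copula_tail C L by unfold_locales fact+
    show ?thesis
      using evd_G std_G domain_of_attraction_G gpd_W gpd_expansion_W[OF assms(2)] is_norm_D norm_expansion_D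
      by blast
  qed
  have W_G: "\<exists>x0. (\<forall>i. x0 $ i < 0) \<and> (\<forall>x. x0 \<le> x \<and> x \<le> 0 \<longrightarrow> W x = 1 + ln (G x))"
    if G: "evd G \<and> std_neg_exp_margins G \<and> in_domain_of_attraction C G"
      and W: "gpd_uniform W \<and> gpd_expansion N C W" for G W
  proof -
    obtain G' x0 where G': "\<forall>i. x0 $ i < 0" "\<forall>x. x0 \<le> x \<and> x \<le> 0 \<longrightarrow> W x = 1 + ln (G' x)"
        "tail_limit C (\<lambda>x. - ln (G' x))"
      using from_W[OF W] by blast
    \<comment> \<open>\<open>G'\<close> is the EVD hidden in \<open>gpd_uniform\<close>; uniqueness
      of the tail limit identifies its logarithm with that of \<open>G\<close> on the negative
      orthant, so its \<open>x0\<close> serves for \<open>G\<close> too.\<close>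
    have "ln (G' x) = ln (G x)" if "x \<le> 0" for x
      using tail_limit_unique[OF G'(3) from_G[OF G] that] by simp
    with G' show ?thesis by (intro exI[of _ x0]) simp
  qed
  have D_G: "G x = exp (- D x)"
    if G: "evd G \<and> std_neg_exp_margins G \<and> in_domain_of_attraction C G"
      and D: "is_norm D \<and> norm_expansion C D" and x: "x \<le> 0" for G D x
  proof -
    have "ln (G x) = - D x"
      using tail_limit_unique[OF from_D[OF D] from_G[OF G] x] by simp
    \<comment> \<open>Equality of logarithms determines \<open>G x\<close> only among positive
      values.\<close>
    moreover have "0 < G x" using G x by (intro evd_pos) auto
    ultimately show ?thesis by (metis exp_ln)
  qed
  show ?thesis
    using from_G from_W from_D all W_G D_G by meson
qed

end
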